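(* Assume that $$\lim_{|\theta|\to+\infty}\left(\psi(\theta)-2\psi\left(\tfrac{\theta}{2}\right)\right)=+\infty\qquad\text{and}\qquad\exists\,\delta>0,\quad\theta\mapsto\psi(\theta)-\delta|\theta|^2\ \text{is concave on }\mathbb{R}^d,$$ that $\mathbb{E}\left[|X|F^2(X)e^{\langle\theta,X\rangle}\right]<+\infty$ for every $\theta\in\mathbb{R}^d$, and that for some real constants $C>0$ and $\lambda\ge0$, $$\forall\,x\in\mathbb{R}^d,\quad|F(x)|\le Ce^{\frac{\lambda}{4}|x|}\qquad\text{and}\qquad\mathbb{E}\left[|X|^2e^{\lambda|X|}\right]<+\infty .$$ Let $(\gamma_n)_{n\ge1}$ be a sequence of positive real numbers with $\sum_{n\ge1}\gamma_n=+\infty$ and $\sum_{n\ge1}\gamma_n^2<+\infty$, let $(\xi_n)_{n\ge1}$ be an i.i.d. sequence with the same distribution as $\xi$, and define $$H(\theta,x):=e^{-\frac{\lambda}{2}\sqrt d\,|\nabla\psi(-\theta)|}F^2(x)\left(\nabla\psi(\theta)-x\right),\qquad\theta,x\in\mathbb{R}^d .$$ Then the recursive procedure $$X_{n+1}^{(-\theta_n)}=g(-\theta_n,\xi_{n+1}),\qquad\theta_{n+1}=\theta_n-\gamma_{n+1}H\left(\theta_n,X_{n+1}^{(-\theta_n)}\right),\quad n\ge0,\qquad\theta_0\in\mathbb{R}^d,$$ converges almost surely toward an $\operatorname{Argmin}V$-valued square integrable random vector $\theta^*$.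
   Context: $X$ is an $\mathbb{R}^d$-valued random vector whose distribution has a probability density $p$ with respect to Lebesgue measure, with $p(x)>0$ for every $x\in\mathbb{R}^d$. $F:\mathbb{R}^d\to\mathbb{R}$ is a Borel function with $\mathbb{E}[F(X)^2]<+\infty$ and $\mathbb{P}(F(X)\neq0)>0$. The cumulant generating function $\psi(\theta)=\log\mathbb{E}[e^{\langle\theta,X\rangle}]$ is assumed finite for every $\theta\in\mathbb{R}^d$. The Esscher-transformed densities are $p_\theta(x)=e^{\langle\theta,x\rangle-\psi(\theta)}p(x)$, $x,\theta\in\mathbb{R}^d$. It is assumed that they can be simulated as follows: there are a random variable $\xi$ with values in a Borel subset $\mathcal{X}$ of a metric space and a Borel function $g:\mathbb{R}^d\times\mathcal{X}\to\mathbb{R}^d$ such that, for every $\theta\in\mathbb{R}^d$, $X^{(\theta)}=g(\theta,\xi)$ has density $p_\theta$. Finally $$V(\theta)=\mathbb{E}\left[F^2(X)\frac{p(X)}{p_\theta(X)}\right]=\mathbb{E}\left[F^2(X)e^{-\langle\theta,X\rangle+\psi(\theta)}\right],\qquad\theta\in\mathbb{R}^d,$$ and $\operatorname{Argmin}V$ is the set of global minimizers of $V$ on $\mathbb{R}^d$. *)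

theory Defs
  imports "HOL-Probability.Probability"
begin

definition gradient :: "('v::real_inner \<Rightarrow> real) \<Rightarrow> 'v \<Rightarrow> 'v"
  where "gradient f x = (THE D. GDERIV f x :> D)"

lemma gradient_eqI:
  assumes "GDERIV f x :> D"
  shows "gradient f x = D"
  unfolding gradient_def
proof (rule the_equality[where P = "\<lambda>D. GDERIV f x :> D", OF assms])
  fix E assume "GDERIV f x :> E"
  with assms have "(\<lambda>h. inner h E) = (\<lambda>h. inner h D)"
    unfolding gderiv_def by (rule has_derivative_unique[rotated])
  then show "E = D"
    by (metis inner_commute vector_eq_rdot)
qed

definition Argmin :: "('v \<Rightarrow> 'r::ord) \<Rightarrow> 'v set"
  where "Argmin f = {x. is_arg_min f (\<lambda>_. True) x}"

definition cgf :: "'a measure \<Rightarrow> ('a \<Rightarrow> real ^ 'n) \<Rightarrow> real ^ 'n \<Rightarrow> real"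
  where "cgf M X \<theta> = ln (\<integral>\<omega>. exp (\<theta> \<bullet> X \<omega>) \<partial>M)"

definition esscher_density ::
    "'a measure \<Rightarrow> ('a \<Rightarrow> real ^ 'n) \<Rightarrow> (real ^ 'n \<Rightarrow> real) \<Rightarrow> real ^ 'n \<Rightarrow> real ^ 'n \<Rightarrow> real"
  where "esscher_density M X p \<theta> x = exp (\<theta> \<bullet> x - cgf M X \<theta>) * p x"

(* The integrand is nonnegative, so the expectation is taken in [0, \<infinity>]: a Bochner integral
   would give the value 0 where the expectation diverges and so could spoil Argmin. *)
definition importance_variance ::
    "'a measure \<Rightarrow> ('a \<Rightarrow> real ^ 'n) \<Rightarrow> (real ^ 'n \<Rightarrow> real) \<Rightarrow> (real ^ 'n \<Rightarrow> real) \<Rightarrow> real ^ 'n \<Rightarrow> ennreal"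
  where "importance_variance M X p F \<theta> =
    (\<integral>\<^sup>+\<omega>. ennreal ((F (X \<omega>))\<^sup>2 * (p (X \<omega>) / esscher_density M X p \<theta> (X \<omega>))) \<partial>M)"

definition update_field ::
    "'a measure \<Rightarrow> ('a \<Rightarrow> real ^ 'n) \<Rightarrow> (real ^ 'n \<Rightarrow> real) \<Rightarrow> real \<Rightarrow> real ^ 'n \<Rightarrow> real ^ 'n \<Rightarrow> real ^ 'n"
  where "update_field M X F lam \<theta> x =
    (exp (- (lam / 2 * sqrt (real CARD('n)) * norm (gradient (cgf M X) (- \<theta>)))) * (F x)\<^sup>2)
      *\<^sub>R (gradient (cgf M X) \<theta> - x)"

end

theory Submission
  imports Defs
begin

text \<open>
  Every element of the family \<open>\<theta> \<mapsto> exp (\<psi> \<theta> - \<theta> \<bullet> x)\<close> is convex, strictly so for almost every \<open>x\<close> along any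
  given line because hyperplanes are null sets. Hence \<open>V\<close> is strictly convex, and the first condition makes
  it coercive, so it has exactly one minimizer \<open>\<theta>s\<close> and the random limit is that constant.

  Semiconcavity of \<open>\<psi>\<close> makes the tilted laws uniformly sub-Gaussian around their means. The damping
  factor in \<open>H\<close> compensates the exponential growth of \<open>F\<close>, so that \<open>H\<close> has a second
  moment of order \<open>1 + |\<theta>|\<^sup>2\<close> under the sampling law, while its mean is a positive multiple of the gradient of
  \<open>V\<close>. With \<open>W n = |\<theta> n - \<theta>s|\<^sup>2\<close> and \<open>t n\<close> the tail of \<open>\<Sum> (\<gamma> k)\<^sup>2\<close>, the process
  \<open>(1 + W n) exp (K t n) - 1\<close> is a nonnegative supermartingale whose drift controls \<open>V (\<theta> n) - V \<theta>s\<close>.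
  It is almost surely bounded and has infimum zero; the maximal inequality restarted at the first
  time it is small shows that it tends to zero. No martingale convergence theorem is needed.
\<close>

section \<open>Nonnegative supermartingales\<close>

text \<open>Sampling at \<open>- \<theta>\<close> is what makes the noise tractable. The likelihood
  ratio of that law is \<open>exp (- \<theta> \<bullet> x - \<psi> (- \<theta>))\<close>, which up
  to a factor free of \<open>x\<close> is the exponential already present in \<open>V\<close>. No
  importance ratio is left in the recursion, only \<open>F^2\<close> and a displacement. Nothing is
  differentiated under an integral. \<open>tilted_mean\<close> and \<open>G\<close> enter as slopes
  of supporting hyperplanes, obtained by integrating \<open>1 + t \<le> exp t\<close>;
  differentiability of \<open>\<psi>\<close> then follows by squeezing it between a tangent and a
  quadratic. The supporting hyperplane of \<open>V\<close> yields a drift expressed by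
  \<open>V\<close> itself, which is continuous because it is convex. Conditional expectations are
  replaced by integrals over events of the past, taken in \<open>ennreal\<close>, so no
  integrability of the iterates has to be carried along.\<close>

locale nn_supermartingale = prob_space M for M :: "'a measure" +
  fixes F :: "nat \<Rightarrow> 'a measure" and Z :: "nat \<Rightarrow> 'a \<Rightarrow> ennreal"
  assumes sub: "\<And>n. subalgebra M (F n)" and mono: "\<And>n. sets (F n) \<subseteq> sets (F (Suc n))"
    and meas: "\<And>n. Z n \<in> borel_measurable (F n)"
    and super: "\<And>n B. B \<in> sets (F n) \<Longrightarrow> (\<integral>\<^sup>+\<omega>\<in>B. Z (Suc n) \<omega> \<partial>M) \<le> (\<integral>\<^sup>+\<omega>\<in>B. Z n \<omega> \<partial>M)"
begin

lemma Z_measurable[measurable]: "Z n \<in> borel_measurable M"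
  using measurable_from_subalg[OF sub meas] .

lemma space_F: "space (F n) = space M"
  using sub[of n] by (simp add: subalgebra_def)

text \<open>Induction on the horizon \<open>N\<close>, for all starting times \<open>j\<close> and
  events \<open>B\<close> at once. \<open>B\<close> is split by whether the level is reached at time
  \<open>j\<close>. If so, Markov's bound applies; the rest \<open>E\<close> is known at time
  \<open>j\<close>, hence at \<open>Suc j\<close>, so the induction hypothesis applies to it, and
  \<open>super\<close> brings the integral of \<open>Z (Suc j)\<close> back to one of
  \<open>Z j\<close>.\<close>

lemma supermartingale_maximal_finite:
  assumes B: "B \<in> sets (F j)"
  shows "a * emeasure M {\<omega>\<in>B. \<exists>i\<le>N. a \<le> Z (j + i) \<omega>} \<le> (\<integral>\<^sup>+\<omega>\<in>B. Z j \<omega> \<partial>M)"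
  using B
proof (induction N arbitrary: j B)
  case 0
  have BM: "B \<in> sets M" using 0 sub[of j] by (auto simp: subalgebra_def)
  have "a * emeasure M {\<omega>\<in>B. a \<le> Z j \<omega>} = (\<integral>\<^sup>+\<omega>. a * indicator {\<omega>\<in>B. a \<le> Z j \<omega>} \<omega> \<partial>M)"
  proof (rule nn_integral_cmult_indicator[symmetric])
    have "{\<omega>\<in>B. a \<le> Z j \<omega>} = B \<inter> {\<omega>\<in>space M. a \<le> Z j \<omega>}"
      using sets.sets_into_space[OF BM] by auto
    then show "{\<omega>\<in>B. a \<le> Z j \<omega>} \<in> sets M" using BM by simp
  qed
  also have "\<dots> \<le> (\<integral>\<^sup>+\<omega>\<in>B. Z j \<omega> \<partial>M)"
    by (intro nn_integral_mono) (auto simp: indicator_def)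
  finally show ?case by simp
next
  case (Suc N)
  have Bsub: "B \<subseteq> space M" using sets.sets_into_space[OF Suc.prems] space_F by simp
  have BM[measurable]: "B \<in> sets M" using Suc.prems sub[of j] by (auto simp: subalgebra_def)
  define A where "A = {\<omega>\<in>B. a \<le> Z j \<omega>}"
  define E where "E = {\<omega>\<in>B. \<not> a \<le> Z j \<omega>}"
  have AE: "A = B \<inter> {\<omega>\<in>space (F j). a \<le> Z j \<omega>}" "E = B \<inter> {\<omega>\<in>space (F j). \<not> a \<le> Z j \<omega>}"
    using Bsub by (auto simp: A_def E_def space_F)
  note [measurable] = meas[of j]
  have AF: "A \<in> sets (F j)" and EF: "E \<in> sets (F j)"
    unfolding AE using Suc.prems by auto
  have [measurable]: "A \<in> sets M" "E \<in> sets M"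
    using AF EF sub[of j] by (auto simp: subalgebra_def)
  have EF': "E \<in> sets (F (Suc j))" using EF mono by blast
  define E' where "E' = {\<omega>\<in>E. \<exists>i\<le>N. a \<le> Z (Suc j + i) \<omega>}"
  have E'eq: "E' = (\<Union>i\<le>N. E \<inter> {\<omega>\<in>space M. a \<le> Z (Suc j + i) \<omega>})"
    using Bsub by (auto simp: E'_def E_def)
  have [measurable]: "E' \<in> sets M" unfolding E'eq by measurable
  have "{\<omega>\<in>B. \<exists>i\<le>Suc N. a \<le> Z (j + i) \<omega>} \<subseteq> A \<union> E'"
  proof
    fix \<omega> assume "\<omega> \<in> {\<omega>\<in>B. \<exists>i\<le>Suc N. a \<le> Z (j + i) \<omega>}"
    then obtain i where i: "\<omega> \<in> B" "i \<le> Suc N" "a \<le> Z (j + i) \<omega>" by auto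
    show "\<omega> \<in> A \<union> E'"
    proof (cases "a \<le> Z j \<omega>")
      case False
      with i obtain k where "i = Suc k" by (cases i) auto
      with i False show ?thesis by (auto simp: A_def E'_def E_def intro!: exI[of _ k])
    qed (use i in \<open>auto simp: A_def\<close>)
  qed
  then have "a * emeasure M {\<omega>\<in>B. \<exists>i\<le>Suc N. a \<le> Z (j + i) \<omega>} \<le> a * emeasure M (A \<union> E')"
    by (intro mult_left_mono emeasure_mono) auto
  also have "\<dots> \<le> a * (emeasure M A + emeasure M E')"
    by (intro mult_left_mono emeasure_subadditive) auto
  also have "\<dots> = a * emeasure M A + a * emeasure M E'" by (simp add: distrib_left)
  also have "a * emeasure M A = (\<integral>\<^sup>+\<omega>. a * indicator A \<omega> \<partial>M)"
    by (rule nn_integral_cmult_indicator[symmetric]) simp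
  also have "\<dots> \<le> (\<integral>\<^sup>+\<omega>\<in>A. Z j \<omega> \<partial>M)"
    by (intro nn_integral_mono) (auto simp: indicator_def A_def)
  also have "a * emeasure M E' \<le> (\<integral>\<^sup>+\<omega>\<in>E. Z (Suc j) \<omega> \<partial>M)"
    unfolding E'_def by (rule Suc.IH[OF EF'])
  also have "\<dots> \<le> (\<integral>\<^sup>+\<omega>\<in>E. Z j \<omega> \<partial>M)" by (rule super[OF EF])
  also have "(\<integral>\<^sup>+\<omega>\<in>A. Z j \<omega> \<partial>M) + (\<integral>\<^sup>+\<omega>\<in>E. Z j \<omega> \<partial>M)
      = (\<integral>\<^sup>+\<omega>. Z j \<omega> * indicator A \<omega> + Z j \<omega> * indicator E \<omega> \<partial>M)"
    by (rule nn_integral_add[symmetric]) auto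
  also have "\<dots> = (\<integral>\<^sup>+\<omega>\<in>B. Z j \<omega> \<partial>M)"
    by (intro nn_integral_cong) (auto simp: indicator_def A_def E_def)
  finally show ?case by (simp add: add_mono)
qed

lemma supermartingale_maximal:
  assumes B: "B \<in> sets (F j)"
  shows "a * emeasure M {\<omega>\<in>B. \<exists>i. a \<le> Z (j + i) \<omega>} \<le> (\<integral>\<^sup>+\<omega>\<in>B. Z j \<omega> \<partial>M)"
proof -
  have BM[measurable]: "B \<in> sets M" using B sub[of j] by (auto simp: subalgebra_def)
  define A where "A N = {\<omega>\<in>B. \<exists>i\<le>N. a \<le> Z (j + i) \<omega>}" for N
  have Aeq: "A N = (\<Union>i\<le>N. B \<inter> {\<omega>\<in>space M. a \<le> Z (j + i) \<omega>})" for N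
    using sets.sets_into_space[OF BM] by (auto simp: A_def)
  have [measurable]: "A N \<in> sets M" for N unfolding Aeq by measurable
  have "incseq A" unfolding incseq_def A_def using order_trans by blast
  then have "emeasure M (\<Union>N. A N) = (SUP N. emeasure M (A N))"
    by (intro SUP_emeasure_incseq[symmetric]) auto
  moreover have "(\<Union>N. A N) = {\<omega>\<in>B. \<exists>i. a \<le> Z (j + i) \<omega>}" by (auto simp: A_def)
  ultimately have "a * emeasure M {\<omega>\<in>B. \<exists>i. a \<le> Z (j + i) \<omega>} = (SUP N. a * emeasure M (A N))"
    by (simp add: SUP_mult_left_ennreal)
  also have "\<dots> \<le> (\<integral>\<^sup>+\<omega>\<in>B. Z j \<omega> \<partial>M)"
    unfolding A_def by (intro SUP_least supermartingale_maximal_finite[OF B])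
  finally show ?thesis .
qed

text \<open>The disjoint events \<open>E j\<close> record the first time at which \<open>Z\<close>
  is at most \<open>c\<close>. Each is known at time \<open>j\<close>, so the maximal inequality can
  be restarted there with \<open>Z j \<le> c\<close>. Summing over \<open>j\<close> costs
  \<open>c\<close> times a probability, whatever the initial value was.\<close>

lemma supermartingale_restart:
  shows "a * emeasure M {\<omega>\<in>space M. \<exists>m n. m \<le> n \<and> Z m \<omega> \<le> c \<and> a \<le> Z n \<omega>} \<le> c"
proof -
  have F_le: "i \<le> j \<Longrightarrow> sets (F i) \<subseteq> sets (F j)" for i j
    using lift_Suc_mono_le[of "\<lambda>i. sets (F i)", OF mono] .
  define E where "E j = {\<omega>\<in>space M. Z j \<omega> \<le> c \<and> (\<forall>i<j. \<not> Z i \<omega> \<le> c)}" for j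
  have EF: "E j \<in> sets (F j)" for j
  proof -
    have *: "{\<omega>\<in>space (F j). Z i \<omega> \<le> c} \<in> sets (F j)" if "i \<le> j" for i
    proof -
      have "Z i \<in> borel_measurable (F j)"
        using measurable_from_subalg[of "F j" "F i" "Z i" borel] meas[of i] F_le[OF that]
        by (auto simp: subalgebra_def space_F)
      then show ?thesis by simp
    qed
    have "E j = {\<omega>\<in>space (F j). Z j \<omega> \<le> c} - (\<Union>i<j. {\<omega>\<in>space (F j). Z i \<omega> \<le> c})"
      by (auto simp: E_def space_F)
    also have "\<dots> \<in> sets (F j)" using * by (intro sets.Diff sets.finite_UN) auto
    finally show ?thesis .
  qed
  have [measurable]: "E j \<in> sets M" for j using EF[of j] sub[of j] by (auto simp: subalgebra_def)
  have disj: "disjoint_family E"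
    unfolding disjoint_family_on_def E_def by (auto simp: set_eq_iff) (metis linorder_neqE_nat)
  define A where "A j = {\<omega>\<in>E j. \<exists>i. a \<le> Z (j + i) \<omega>}" for j
  have Aeq: "A j = (\<Union>i. E j \<inter> {\<omega>\<in>space M. a \<le> Z (j + i) \<omega>})" for j
    by (auto simp: A_def E_def)
  have [measurable]: "A j \<in> sets M" for j unfolding Aeq by measurable
  have "{\<omega>\<in>space M. \<exists>m n. m \<le> n \<and> Z m \<omega> \<le> c \<and> a \<le> Z n \<omega>} \<subseteq> (\<Union>j. A j)"
  proof
    fix \<omega> assume "\<omega> \<in> {\<omega>\<in>space M. \<exists>m n. m \<le> n \<and> Z m \<omega> \<le> c \<and> a \<le> Z n \<omega>}"
    then obtain m n where mn: "\<omega> \<in> space M" "m \<le> n" "Z m \<omega> \<le> c" "a \<le> Z n \<omega>" by auto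
    define j where "j = (LEAST j. Z j \<omega> \<le> c)"
    have "Z j \<omega> \<le> c" "j \<le> m" "\<And>i. i < j \<Longrightarrow> \<not> Z i \<omega> \<le> c"
      unfolding j_def using mn(3) by (auto intro: LeastI Least_le dest: not_less_Least)
    then have "\<omega> \<in> A j"
      using mn by (auto simp: A_def E_def intro!: exI[of _ "n - j"])
    then show "\<omega> \<in> (\<Union>j. A j)" by blast
  qed
  then have "a * emeasure M {\<omega>\<in>space M. \<exists>m n. m \<le> n \<and> Z m \<omega> \<le> c \<and> a \<le> Z n \<omega>}
      \<le> a * emeasure M (\<Union>j. A j)"
    by (intro mult_left_mono emeasure_mono) auto
  also have "\<dots> \<le> a * (\<Sum>j. emeasure M (A j))"
    by (intro mult_left_mono emeasure_subadditive_countably) auto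
  also have "\<dots> = (\<Sum>j. a * emeasure M (A j))" by simp
  also have "\<dots> \<le> (\<Sum>j. c * emeasure M (E j))"
  proof (intro suminf_le)
    fix j
    have "a * emeasure M (A j) \<le> (\<integral>\<^sup>+\<omega>\<in>E j. Z j \<omega> \<partial>M)"
      unfolding A_def by (rule supermartingale_maximal[OF EF])
    also have "\<dots> \<le> (\<integral>\<^sup>+\<omega>. c * indicator (E j) \<omega> \<partial>M)"
      by (intro nn_integral_mono) (auto simp: indicator_def E_def)
    also have "\<dots> = c * emeasure M (E j)"
      by (rule nn_integral_cmult_indicator) simp
    finally show "a * emeasure M (A j) \<le> c * emeasure M (E j)" .
  qed auto
  also have "\<dots> = c * (\<Sum>j. emeasure M (E j))" by simp
  also have "(\<Sum>j. emeasure M (E j)) = emeasure M (\<Union>j. E j)"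
    using disj by (intro suminf_emeasure) auto
  also have "c * \<dots> \<le> c * 1" by (intro mult_left_mono) (auto simp: emeasure_le_1)
  finally show ?thesis by simp
qed

text \<open>For a fixed level \<open>a\<close>, the event \<open>A a c\<close> of climbing to
  \<open>a\<close> after having been at most \<open>c\<close> has probability of order
  \<open>c\<close>, so the intersection over small \<open>c\<close> is null. Off these null sets
  every level \<open>e k\<close> has some \<open>e l\<close> such that \<open>Z\<close> never
  returns to \<open>e k\<close> once it is at most \<open>e l\<close>, and the assumption says that
  \<open>e l\<close> is reached.\<close>

lemma supermartingale_tendsto_0:
  assumes inf: "AE \<omega> in M. \<forall>c>0. \<exists>n. Z n \<omega> \<le> c"
  shows "AE \<omega> in M. (\<lambda>n. Z n \<omega>) \<longlonglongrightarrow> 0"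
proof -
  define A where "A a c = {\<omega>\<in>space M. \<exists>m n. m \<le> n \<and> Z m \<omega> \<le> c \<and> a \<le> Z n \<omega>}" for a c
  have A: "a * emeasure M (A a c) \<le> c" for a c
    unfolding A_def by (rule supermartingale_restart)
  have [measurable]: "A a c \<in> sets M" for a c unfolding A_def by measurable
  define e where "e k = ennreal (inverse (real (Suc k)))" for k
  have e0: "e k > 0" for k by (simp add: e_def)
  have ex: "\<exists>k. e k < c" if "c > 0" for c
  proof (cases c)
    case (real r)
    with that have "r > 0" by simp
    then obtain k where "inverse (real (Suc k)) < r" using reals_Archimedean by blast
    then show ?thesis using real by (auto simp: e_def ennreal_less_iff intro!: exI[of _ k])
  qed (auto simp: e_def)
  have "emeasure M (\<Inter>l. A (e k) (e l)) = 0" for k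
  proof -
    let ?m = "emeasure M (\<Inter>l. A (e k) (e l))"
    have "e k * ?m \<le> e l" for l
    proof -
      have "e k * ?m \<le> e k * emeasure M (A (e k) (e l))"
        by (intro mult_left_mono emeasure_mono) auto
      also have "\<dots> \<le> e l" by (rule A)
      finally show ?thesis .
    qed
    then have "e k * ?m = 0" using ex not_less by (metis not_gr_zero)
    then show ?thesis using e0[of k] by (auto simp: less_imp_neq)
  qed
  then have "AE \<omega> in M. \<omega> \<notin> (\<Inter>l. A (e k) (e l))" for k
    by (intro AE_not_in) (auto intro!: null_setsI)
  then have "AE \<omega> in M. \<forall>k. \<omega> \<notin> (\<Inter>l. A (e k) (e l))" by (simp add: AE_all_countable)
  with inf AE_space show ?thesis
  proof eventually_elim
    case (elim \<omega>)
    show ?case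
    proof (rule order_tendstoI)
      fix a :: ennreal assume "0 < a"
      then obtain k where k: "e k < a" using ex by blast
      from elim(3) obtain l where "\<omega> \<notin> A (e k) (e l)" by blast
      moreover obtain m where "Z m \<omega> \<le> e l" using elim(1) e0 by blast
      ultimately have "\<And>n. m \<le> n \<Longrightarrow> Z n \<omega> < e k"
        using elim(2) unfolding A_def by (metis (mono_tags, lifting) mem_Collect_eq not_le)
      then show "\<forall>\<^sub>F n in sequentially. Z n \<omega> < a"
        using k unfolding eventually_sequentially by (meson less_trans)
    qed simp
  qed
qed

end

text \<open>If \<open>m\<close> is the measure of the event that every level is reached, the maximal
  inequality bounds \<open>of_nat r * m\<close> by the initial integral for all \<open>r\<close>,
  which forces \<open>m = 0\<close>.\<close>

lemma (in nn_supermartingale) bounded_AE: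
  assumes fin: "(\<integral>\<^sup>+\<omega>. Z 0 \<omega> \<partial>M) < \<infinity>"
  shows "AE \<omega> in M. \<exists>r::nat. \<forall>n. Z n \<omega> < of_nat r"
proof -
  define A where "A r = {\<omega>\<in>space M. \<exists>i. of_nat r \<le> Z i \<omega>}" for r :: nat
  have [measurable]: "A r \<in> sets M" for r unfolding A_def by measurable
  have A: "of_nat r * emeasure M (A r) \<le> (\<integral>\<^sup>+\<omega>. Z 0 \<omega> \<partial>M)" for r
  proof -
    have "of_nat r * emeasure M (A r) \<le> (\<integral>\<^sup>+\<omega>\<in>space M. Z 0 \<omega> \<partial>M)"
      using supermartingale_maximal[of "space M" 0 "of_nat r"] sets.top[of "F 0"]
      by (simp add: A_def space_F)
    also have "\<dots> = (\<integral>\<^sup>+\<omega>. Z 0 \<omega> \<partial>M)" by (intro nn_integral_cong) auto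
    finally show ?thesis .
  qed
  have "of_nat r * emeasure M (\<Inter>r. A r) \<le> (\<integral>\<^sup>+\<omega>. Z 0 \<omega> \<partial>M)" for r
  proof -
    have "of_nat r * emeasure M (\<Inter>r. A r) \<le> of_nat r * emeasure M (A r)"
      by (intro mult_left_mono emeasure_mono) auto
    also note A
    finally show ?thesis .
  qed
  then have "(SUP r. of_nat r * emeasure M (\<Inter>r. A r)) < \<infinity>"
    using fin SUP_least le_less_trans by (metis (no_types, lifting))
  then have "emeasure M (\<Inter>r. A r) = 0"
    by (simp add: SUP_mult_right_ennreal[symmetric] ennreal_SUP_of_nat_eq_top ennreal_top_mult split: if_splits)
  then have "AE \<omega> in M. \<omega> \<notin> (\<Inter>r. A r)"
    by (intro AE_not_in) auto
  with AE_space show ?thesis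
    by eventually_elim (auto simp: A_def not_le)
qed

text \<open>An argument of Robbins-Siegmund type. Summing the descent bounds the expectation of the
  series of \<open>g n * b (x n)\<close>, which therefore converges almost surely. As
  \<open>g\<close> is not summable, a bounded path cannot stay away from \<open>xs\<close>; this
  gives the vanishing infimum required by \<open>supermartingale_tendsto_0\<close>.\<close>

lemma (in prob_space) stochastic_descent_tendsto:
  fixes F :: "nat \<Rightarrow> 'a measure" and x :: "nat \<Rightarrow> 'a \<Rightarrow> 'v::euclidean_space" and b :: "'v \<Rightarrow> real"
    and g :: "nat \<Rightarrow> real"
  assumes sub: "\<And>n. subalgebra M (F n)" and mono: "\<And>n. sets (F n) \<subseteq> sets (F (Suc n))"
    and meas: "\<And>n. x n \<in> borel_measurable (F n)"
    and init: "\<And>\<omega>. \<omega> \<in> space M \<Longrightarrow> x 0 \<omega> = x0"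
    and K: "K \<ge> 0" and g: "\<And>n. g n > 0" "\<not> summable g" "summable (\<lambda>n. (g n)\<^sup>2)"
    and b: "continuous_on UNIV b" "\<And>v. b v \<ge> 0" "\<And>v. v \<noteq> xs \<Longrightarrow> b v > 0"
    and descent: "\<And>n B. B \<in> sets (F n) \<Longrightarrow>
      (\<integral>\<^sup>+\<omega>\<in>B. ennreal ((norm (x (Suc n) \<omega> - xs))\<^sup>2) \<partial>M)
        + (\<integral>\<^sup>+\<omega>\<in>B. ennreal (2 * g n * b (x n \<omega>)) \<partial>M)
      \<le> (\<integral>\<^sup>+\<omega>\<in>B. ennreal ((1 + K * (g n)\<^sup>2) * (norm (x n \<omega> - xs))\<^sup>2 + K * (g n)\<^sup>2) \<partial>M)"
  shows "AE \<omega> in M. (\<lambda>n. x n \<omega>) \<longlonglongrightarrow> xs"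
proof -
  have [measurable]: "b \<in> borel_measurable borel"
    using b(1) by (rule borel_measurable_continuous_onI)
  have xM[measurable]: "x n \<in> borel_measurable M" for n
    using measurable_from_subalg[OF sub meas] .
  define t where "t n = (\<Sum>i. (g (i + n))\<^sup>2)" for n
  have sums: "summable (\<lambda>i. (g (i + n))\<^sup>2)" for n
    using g(3) by (subst summable_iff_shift)
  have t_Suc: "t n = (g n)\<^sup>2 + t (Suc n)" for n
    using suminf_split_head[OF sums[of n]] by (simp add: t_def)
  have t_nonneg: "t n \<ge> 0" for n
    unfolding t_def by (intro suminf_nonneg sums) auto
  have t_0: "t \<longlonglongrightarrow> 0"
    unfolding t_def using suminf_exist_split2[OF g(3)] by simp
  define W where "W n \<omega> = (norm (x n \<omega> - xs))\<^sup>2" for n \<omega>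
  have W0: "W n \<omega> \<ge> 0" for n \<omega> by (simp add: W_def)
  have [measurable]: "W n \<in> borel_measurable M" for n unfolding W_def by measurable
  define e where "e n = exp (K * t n)" for n
  have e1: "e n \<ge> 1" for n using K t_nonneg by (simp add: e_def)
  have e_Suc: "(1 + K * (g n)\<^sup>2) * e (Suc n) \<le> e n" for n
  proof -
    have "(1 + K * (g n)\<^sup>2) * e (Suc n) \<le> exp (K * (g n)\<^sup>2) * e (Suc n)"
      using e1[of "Suc n"] by (intro mult_right_mono exp_ge_add_one_self) auto
    also have "\<dots> = e n" by (simp add: e_def t_Suc[of n] exp_add[symmetric] algebra_simps)
    finally show ?thesis .
  qed
  \<comment> \<open>Adding 1 turns the affine growth allowed by \<open>descent\<close> into a
    multiplicative one: in mean, \<open>1 + W\<close> grows at most by the factor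
    \<open>1 + K * (g n)^2\<close>, which \<open>e\<close> compensates. Subtracting 1 makes 0 the
    value to be reached, since \<open>e\<close> tends to 1.\<close>
  define Z where "Z n \<omega> = (1 + W n \<omega>) * e n - 1" for n \<omega>
  have WZ: "W n \<omega> \<le> Z n \<omega>" for n \<omega>
  proof -
    have "(1 + W n \<omega>) * 1 \<le> (1 + W n \<omega>) * e n"
      using W0[of n \<omega>] e1[of n] by (intro mult_left_mono) auto
    then show ?thesis by (simp add: Z_def)
  qed
  have Z0: "Z n \<omega> \<ge> 0" for n \<omega> using WZ W0 order_trans by blast
  have [measurable]: "Z n \<in> borel_measurable M" for n unfolding Z_def by measurable
  have drift: "(\<integral>\<^sup>+\<omega>\<in>B. ennreal (Z (Suc n) \<omega>) \<partial>M) + (\<integral>\<^sup>+\<omega>\<in>B. ennreal (2 * g n * b (x n \<omega>)) \<partial>M)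
      \<le> (\<integral>\<^sup>+\<omega>\<in>B. ennreal (Z n \<omega>) \<partial>M)" if BF: "B \<in> sets (F n)" for B n
  proof -
    have [measurable]: "B \<in> sets M" using BF sub[of n] by (auto simp: subalgebra_def)
    let ?I = "\<lambda>f. (\<integral>\<^sup>+\<omega>\<in>B. ennreal (f \<omega>) \<partial>M)"
    let ?e = "e (Suc n)"
    have e1': "?e \<ge> 1" by (rule e1)
    \<comment> \<open>Subtraction in \<open>ennreal\<close> is avoided by writing
      \<open>Z (Suc n)\<close> as \<open>?e * W (Suc n) + (?e - 1)\<close>, with both coefficients
      nonnegative, before the integral is split.\<close>
    have lin: "?I (\<lambda>\<omega>. ?e * f \<omega> + (?e - 1)) = ennreal ?e * ?I f + ?I (\<lambda>_. ?e - 1)"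
      if [measurable]: "f \<in> borel_measurable M" and f0: "\<And>\<omega>. f \<omega> \<ge> 0" for f
    proof -
      have "?I (\<lambda>\<omega>. ?e * f \<omega> + (?e - 1))
          = (\<integral>\<^sup>+\<omega>. ennreal ?e * (ennreal (f \<omega>) * indicator B \<omega>) + ennreal (?e - 1) * indicator B \<omega> \<partial>M)"
        using e1' f0
        by (intro nn_integral_cong) (simp add: ennreal_plus ennreal_mult' distrib_right mult.assoc)
      also have "\<dots> = ennreal ?e * ?I f + ?I (\<lambda>_. ?e - 1)"
        by (subst nn_integral_add) (auto simp: nn_integral_cmult)
      finally show ?thesis .
    qed
    have "?I (Z (Suc n)) + ?I (\<lambda>\<omega>. 2 * g n * b (x n \<omega>))
        = ?I (\<lambda>\<omega>. ?e * W (Suc n) \<omega> + (?e - 1)) + ?I (\<lambda>\<omega>. 2 * g n * b (x n \<omega>))"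
      by (simp add: Z_def algebra_simps)
    also have "\<dots> = ennreal ?e * ?I (W (Suc n)) + ?I (\<lambda>_. ?e - 1) + 1 * ?I (\<lambda>\<omega>. 2 * g n * b (x n \<omega>))"
      using W0 by (subst lin) auto
    \<comment> \<open>Enlarging the drift term by \<open>?e \<ge> 1\<close> makes \<open>?e\<close>
      a common factor, so that \<open>descent\<close> applies to the bracket.\<close>
    also have "\<dots> \<le> ennreal ?e * ?I (W (Suc n)) + ?I (\<lambda>_. ?e - 1)
        + ennreal ?e * ?I (\<lambda>\<omega>. 2 * g n * b (x n \<omega>))"
      using e1' by (intro add_left_mono mult_right_mono) auto
    also have "\<dots> = ennreal ?e * (?I (W (Suc n)) + ?I (\<lambda>\<omega>. 2 * g n * b (x n \<omega>))) + ?I (\<lambda>_. ?e - 1)"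
      by (simp add: distrib_left ac_simps)
    also have "\<dots> \<le> ennreal ?e * ?I (\<lambda>\<omega>. (1 + K * (g n)\<^sup>2) * W n \<omega> + K * (g n)\<^sup>2) + ?I (\<lambda>_. ?e - 1)"
      using descent[OF BF] unfolding W_def by (intro add_right_mono mult_left_mono) auto
    also have "\<dots> = ?I (\<lambda>\<omega>. ?e * ((1 + K * (g n)\<^sup>2) * W n \<omega> + K * (g n)\<^sup>2) + (?e - 1))"
      using W0 K by (subst lin) auto
    also have "\<dots> \<le> ?I (Z n)"
    proof (intro nn_integral_mono mult_right_mono ennreal_leI)
      fix \<omega>
      have "?e * ((1 + K * (g n)\<^sup>2) * W n \<omega> + K * (g n)\<^sup>2) + (?e - 1)
          = (1 + W n \<omega>) * ((1 + K * (g n)\<^sup>2) * ?e) - 1" by (simp add: algebra_simps)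
      also have "\<dots> \<le> Z n \<omega>"
        unfolding Z_def using e_Suc[of n] W0[of n \<omega>] by (intro diff_right_mono mult_left_mono) auto
      finally show "?e * ((1 + K * (g n)\<^sup>2) * W n \<omega> + K * (g n)\<^sup>2) + (?e - 1) \<le> Z n \<omega>" .
    qed auto
    finally show ?thesis .
  qed
  interpret nn_supermartingale M F "\<lambda>n \<omega>. ennreal (Z n \<omega>)"
  proof
    show "(\<lambda>\<omega>. ennreal (Z n \<omega>)) \<in> borel_measurable (F n)" for n
    proof -
      note [measurable] = meas[of n]
      show ?thesis unfolding Z_def W_def by measurable
    qed
    show "(\<integral>\<^sup>+\<omega>\<in>B. ennreal (Z (Suc n) \<omega>) \<partial>M) \<le> (\<integral>\<^sup>+\<omega>\<in>B. ennreal (Z n \<omega>) \<partial>M)"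
      if "B \<in> sets (F n)" for B n
      using drift[OF that] by (meson le_iff_add order_trans)
  qed (use sub mono in auto)
  have Z_init: "(\<integral>\<^sup>+\<omega>. ennreal (Z 0 \<omega>) \<partial>M) < \<infinity>"
  proof -
    have "(\<integral>\<^sup>+\<omega>. ennreal (Z 0 \<omega>) \<partial>M) = (\<integral>\<^sup>+\<omega>. ennreal ((1 + (norm (x0 - xs))\<^sup>2) * e 0 - 1) \<partial>M)"
      by (intro nn_integral_cong) (simp add: Z_def W_def init)
    then show ?thesis by (simp add: emeasure_space_1)
  qed
  have sum_le: "(\<Sum>n<N. \<integral>\<^sup>+\<omega>. ennreal (2 * g n * b (x n \<omega>)) \<partial>M) + (\<integral>\<^sup>+\<omega>. ennreal (Z N \<omega>) \<partial>M)
      \<le> (\<integral>\<^sup>+\<omega>. ennreal (Z 0 \<omega>) \<partial>M)" for N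
  proof (induction N)
    case (Suc N)
    have *: "(\<integral>\<^sup>+\<omega>\<in>space M. f \<omega> \<partial>M) = (\<integral>\<^sup>+\<omega>. f \<omega> \<partial>M)" for f :: "'a \<Rightarrow> ennreal"
      by (intro nn_integral_cong) auto
    have "(\<integral>\<^sup>+\<omega>. ennreal (Z (Suc N) \<omega>) \<partial>M) + (\<integral>\<^sup>+\<omega>. ennreal (2 * g N * b (x N \<omega>)) \<partial>M)
        \<le> (\<integral>\<^sup>+\<omega>. ennreal (Z N \<omega>) \<partial>M)"
      using drift[of "space M" N] sets.top[of "F N"] by (simp add: space_F *)
    then show ?case
      by (intro order_trans[OF _ Suc]) (simp add: add.assoc add.commute add_left_mono)
  qed simp
  have "(\<Sum>n. \<integral>\<^sup>+\<omega>. ennreal (2 * g n * b (x n \<omega>)) \<partial>M) \<le> (\<integral>\<^sup>+\<omega>. ennreal (Z 0 \<omega>) \<partial>M)"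
    unfolding suminf_eq_SUP
    using sum_le by (intro SUP_least) (meson le_iff_add order_trans)
  then have "(\<integral>\<^sup>+\<omega>. (\<Sum>n. ennreal (2 * g n * b (x n \<omega>))) \<partial>M) < \<infinity>"
    using Z_init by (subst nn_integral_suminf) auto
  then have "AE \<omega> in M. (\<Sum>n. ennreal (2 * g n * b (x n \<omega>))) \<noteq> \<infinity>"
    by (intro nn_integral_PInf_AE) auto
  then have "AE \<omega> in M. \<forall>c>0. \<exists>n. ennreal (Z n \<omega>) \<le> c"
    using bounded_AE[OF Z_init]
  proof eventually_elim
    case (elim \<omega>)
    have summ: "summable (\<lambda>n. g n * b (x n \<omega>))"
    proof -
      have "summable (\<lambda>n. 2 * g n * b (x n \<omega>))"
        using elim(1) g(1) b(2) by (intro summable_suminf_not_top) (auto simp: less_imp_le)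
      then show ?thesis using summable_mult[of _ "1/2"] by fastforce
    qed
    from elim(2) obtain r :: nat where r: "\<And>n. Z n \<omega> < real r"
      using Z0 by (auto simp: ennreal_of_nat_eq_real_of_nat ennreal_less_iff)
    show ?case
    proof (rule ccontr)
      assume "\<not> ?case"
      then obtain c where c: "c > 0" "\<And>n. ennreal (Z n \<omega>) > c" by (auto simp: not_le)
      have "c < top" by (rule less_trans[OF c(2)[of 0] ennreal_less_top])
      then obtain d where d: "c = ennreal d" "d \<ge> 0" by (cases c) auto
      with c have d0: "d > 0" and dZ: "\<And>n. Z n \<omega> > d" using Z0 by (auto simp: ennreal_less_iff)
      \<comment> \<open>Since \<open>e\<close> tends to 1, from some \<open>N\<close> on the lower
        bound \<open>d\<close> for \<open>Z\<close> leaves at least \<open>d / 2\<close> for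
        \<open>W\<close>.\<close>
      have "e \<longlonglongrightarrow> exp (K * 0)" unfolding e_def by (intro tendsto_intros t_0)
      then have "(\<lambda>n. (1 + d / 2) * e n) \<longlonglongrightarrow> (1 + d / 2) * exp (K * 0)" by (intro tendsto_intros)
      then have "\<forall>\<^sub>F n in sequentially. (1 + d / 2) * e n < 1 + d"
        using d0 by (intro order_tendstoD(2)) auto
      then obtain N where N: "\<And>n. n \<ge> N \<Longrightarrow> (1 + d / 2) * e n < 1 + d"
        by (auto simp: eventually_sequentially)
      have Wd: "W n \<omega> \<ge> d / 2" if "n \<ge> N" for n
      proof (rule ccontr)
        assume "\<not> W n \<omega> \<ge> d / 2"
        then have "(1 + W n \<omega>) * e n \<le> (1 + d / 2) * e n"
          using e1[of n] by (intro mult_right_mono) auto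
        with N[OF that] dZ[of n] show False by (simp add: Z_def)
      qed
      \<comment> \<open>From \<open>N\<close> on the path lies in this compact annulus, which omits
        \<open>xs\<close>. There \<open>b\<close> has a positive minimum, so summability of
        \<open>g n * b (x n)\<close> would pass to \<open>g\<close>.\<close>
      define A where "A = cball xs (sqrt (real r)) - ball xs (sqrt (d / 2))"
      have "compact A" unfolding A_def by (intro compact_diff) auto
      have xA: "x n \<omega> \<in> A" if "n \<ge> N" for n
      proof -
        have "(norm (x n \<omega> - xs))\<^sup>2 \<le> real r" "(norm (x n \<omega> - xs))\<^sup>2 \<ge> d / 2"
          using WZ[of n \<omega>] r[of n] Wd[OF that] by (auto simp: W_def)
        then have "norm (x n \<omega> - xs) \<le> sqrt r" "norm (x n \<omega> - xs) \<ge> sqrt (d / 2)"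
          by (auto intro!: real_le_rsqrt real_le_lsqrt)
        then show ?thesis by (auto simp: A_def dist_norm norm_minus_commute)
      qed
      then have "A \<noteq> {}" by auto
      with \<open>compact A\<close> b(1) obtain y where y: "y \<in> A" "\<And>v. v \<in> A \<Longrightarrow> b y \<le> b v"
        using continuous_attains_inf[of A b] continuous_on_subset by blast
      have "y \<noteq> xs" using y(1) d0 by (auto simp: A_def)
      then have by0: "b y > 0" by (rule b(3))
      have "summable (\<lambda>n. g n * b y)"
      proof (rule summable_comparison_test')
        show "summable (\<lambda>n. g n * b (x n \<omega>))" by (rule summ)
        show "norm (g n * b y) \<le> g n * b (x n \<omega>)" if "n \<ge> N" for n
          using y(2)[OF xA[OF that]] g(1)[of n] by0 by (auto simp: abs_mult intro!: mult_left_mono)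
      qed
      then have "summable g" using by0 using summable_mult2[of _ "1 / b y"] by fastforce
      with g(2) show False by simp
    qed
  qed
  then have "AE \<omega> in M. (\<lambda>n. ennreal (Z n \<omega>)) \<longlonglongrightarrow> 0"
    by (rule supermartingale_tendsto_0)
  then show ?thesis
  proof eventually_elim
    case (elim \<omega>)
    then have "(\<lambda>n. ennreal (Z n \<omega>)) \<longlonglongrightarrow> ennreal 0" by simp
    then have "(\<lambda>n. Z n \<omega>) \<longlonglongrightarrow> 0"
      using Z0 by (subst (asm) tendsto_ennreal_iff) auto
    then have "(\<lambda>n. W n \<omega>) \<longlonglongrightarrow> 0"
      by (rule tendsto_sandwich[of "\<lambda>_. 0" _ _ "\<lambda>n. Z n \<omega>", rotated 3]) (auto simp: W0 WZ)
    then have "(\<lambda>n. sqrt (W n \<omega>)) \<longlonglongrightarrow> sqrt 0" by (intro tendsto_intros)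
    then have "(\<lambda>n. norm (x n \<omega> - xs)) \<longlonglongrightarrow> 0" by (simp add: W_def)
    then have "(\<lambda>n. x n \<omega> - xs) \<longlonglongrightarrow> 0" by (rule tendsto_norm_zero_cancel)
    then show ?case by (rule LIM_zero_cancel)
  qed
qed

section \<open>The cumulant generating function\<close>

definition sign_vectors :: "(real ^ 'n) set"
  where "sign_vectors = {s. \<forall>i. s $ i \<in> {-1, 1}}"

lemma finite_sign_vectors: "finite (sign_vectors :: (real ^ 'n) set)"
proof -
  have "(sign_vectors :: (real ^ 'n) set) \<subseteq> vec_lambda ` (UNIV \<rightarrow>\<^sub>E {-1, 1 :: real})"
  proof
    fix s :: "real ^ 'n" assume "s \<in> sign_vectors"
    then have "($) s \<in> UNIV \<rightarrow>\<^sub>E {-1, 1 :: real}" by (auto simp: sign_vectors_def)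
    moreover have "s = vec_lambda (($) s)" by simp
    ultimately show "s \<in> vec_lambda ` (UNIV \<rightarrow>\<^sub>E {-1, 1 :: real})" by blast
  qed
  moreover have "finite (vec_lambda ` (UNIV \<rightarrow>\<^sub>E {-1, 1 :: real}) :: (real ^ 'n) set)"
    by (intro finite_imageI finite_PiE) auto
  ultimately show ?thesis by (rule finite_subset)
qed

text \<open>The Euclidean norm is at most the l1 norm, and the l1 norm of \<open>x\<close> equals
  \<open>s \<bullet> x\<close> for the sign pattern \<open>s\<close> of \<open>x\<close>.
  Exponential moments of the norm are thus reduced to finitely many linear ones, which the
  generating function controls.\<close>

lemma exp_norm_le_sum_sign_vectors:
  fixes x :: "real ^ 'n"
  assumes "c \<ge> 0"
  shows "exp (c * norm x) \<le> (\<Sum>s\<in>sign_vectors. exp ((c *\<^sub>R s) \<bullet> x))"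
proof -
  define s :: "real ^ 'n" where "s = (\<chi> i. if x $ i \<ge> 0 then 1 else -1)"
  have s: "s \<in> sign_vectors" by (auto simp: s_def sign_vectors_def)
  have "norm x \<le> (\<Sum>i\<in>UNIV. \<bar>x $ i\<bar>)" by (rule norm_le_l1_cart)
  also have "\<dots> = s \<bullet> x"
    unfolding inner_vec_def by (intro sum.cong) (auto simp: s_def)
  finally have "exp (c * norm x) \<le> exp ((c *\<^sub>R s) \<bullet> x)" using assms by (simp add: mult_left_mono)
  also have "\<dots> \<le> (\<Sum>s\<in>sign_vectors. exp ((c *\<^sub>R s) \<bullet> x))"
    using s finite_sign_vectors by (intro member_le_sum) auto
  finally show ?thesis .
qed

section \<open>Exponential tilting and the tangent inequality\<close>

locale exponential_moments = prob_space M for M :: "'a measure" +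
  fixes X :: "'a \<Rightarrow> real ^ 'n"
  assumes X_measurable[measurable]: "X \<in> borel_measurable M"
    and integrable_exp_inner: "\<And>u. integrable M (\<lambda>\<omega>. exp (u \<bullet> X \<omega>))"
begin

abbreviation \<psi> :: "real ^ 'n \<Rightarrow> real" where "\<psi> \<equiv> cgf M X"

text \<open>Expectation of \<open>X\<close> under the Esscher law with parameter \<open>u\<close>;
  \<open>gradient_cgf\<close> later identifies it with the gradient of
  \<open>\<psi>\<close>.\<close>

definition tilted_mean :: "real ^ 'n \<Rightarrow> real ^ 'n"
  where "tilted_mean u = (\<integral>\<omega>. exp (u \<bullet> X \<omega> - \<psi> u) *\<^sub>R X \<omega> \<partial>M)"

lemma integrable_exp_norm: "integrable M (\<lambda>\<omega>. exp (c * norm (X \<omega>) + u \<bullet> X \<omega>))"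
proof (rule Bochner_Integration.integrable_bound)
  show "integrable M (\<lambda>\<omega>. \<Sum>s\<in>sign_vectors. exp ((\<bar>c\<bar> *\<^sub>R s + u) \<bullet> X \<omega>))"
    by (intro Bochner_Integration.integrable_sum integrable_exp_inner)
  show "AE \<omega> in M. norm (exp (c * norm (X \<omega>) + u \<bullet> X \<omega>))
      \<le> norm (\<Sum>s\<in>sign_vectors. exp ((\<bar>c\<bar> *\<^sub>R s + u) \<bullet> X \<omega>))"
  proof (intro AE_I2)
    fix \<omega>
    have "exp (c * norm (X \<omega>) + u \<bullet> X \<omega>) \<le> exp (\<bar>c\<bar> * norm (X \<omega>)) * exp (u \<bullet> X \<omega>)"
      by (simp add: exp_add[symmetric] mult_right_mono)
    also have "\<dots> \<le> (\<Sum>s\<in>sign_vectors. exp ((\<bar>c\<bar> *\<^sub>R s) \<bullet> X \<omega>)) * exp (u \<bullet> X \<omega>)"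
      by (intro mult_right_mono exp_norm_le_sum_sign_vectors) auto
    also have "\<dots> = (\<Sum>s\<in>sign_vectors. exp ((\<bar>c\<bar> *\<^sub>R s + u) \<bullet> X \<omega>))"
      by (simp add: sum_distrib_right exp_add[symmetric] inner_add_left)
    also have "\<dots> \<le> norm \<dots>" by simp
    finally show "norm (exp (c * norm (X \<omega>) + u \<bullet> X \<omega>))
      \<le> norm (\<Sum>s\<in>sign_vectors. exp ((\<bar>c\<bar> *\<^sub>R s + u) \<bullet> X \<omega>))" by simp
  qed
qed measurable

lemma integrable_exponential_growth:
  fixes f :: "real ^ 'n \<Rightarrow> 'v::{banach, second_countable_topology}"
  assumes [measurable]: "f \<in> borel_measurable borel"
    and le: "\<And>x. norm (f x) \<le> K * exp (c * norm x)"
  shows "integrable M (\<lambda>\<omega>. f (X \<omega>))"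
proof (rule Bochner_Integration.integrable_bound)
  show "integrable M (\<lambda>\<omega>. K * exp (c * norm (X \<omega>)))"
    using integrable_exp_norm[of c 0] by simp
  show "AE \<omega> in M. norm (f (X \<omega>)) \<le> norm (K * exp (c * norm (X \<omega>)))"
    using order_trans[OF le abs_ge_self] by simp
qed measurable

lemma exp_inner_le: "exp (u \<bullet> x) \<le> exp (norm u * norm x)"
  by (simp add: norm_cauchy_schwarz)

lemma mgf_pos: "(\<integral>\<omega>. exp (u \<bullet> X \<omega>) \<partial>M) > 0"
proof -
  have "(\<integral>\<omega>. exp (u \<bullet> X \<omega>) \<partial>M) \<noteq> 0"
    using integral_nonneg_eq_0_iff_AE[OF integrable_exp_inner[of u]] AE_False by simp
  then show ?thesis using Bochner_Integration.integral_nonneg[of M "\<lambda>\<omega>. exp (u \<bullet> X \<omega>)"] by (simp add: order_less_le)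
qed

lemma exp_cgf: "exp (\<psi> u) = (\<integral>\<omega>. exp (u \<bullet> X \<omega>) \<partial>M)"
  using mgf_pos by (simp add: cgf_def)

lemma integral_tilted_exp: "(\<integral>\<omega>. exp (u \<bullet> X \<omega> - \<psi> u) * exp (v \<bullet> X \<omega>) \<partial>M) = exp (\<psi> (u + v) - \<psi> u)"
proof -
  have "(\<integral>\<omega>. exp (u \<bullet> X \<omega> - \<psi> u) * exp (v \<bullet> X \<omega>) \<partial>M) = (\<integral>\<omega>. exp (- \<psi> u) * exp ((u + v) \<bullet> X \<omega>) \<partial>M)"
    by (intro Bochner_Integration.integral_cong) (auto simp: exp_add[symmetric] inner_add_left algebra_simps)
  also have "\<dots> = exp (- \<psi> u) * exp (\<psi> (u + v))" by (simp add: exp_cgf)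
  finally show ?thesis by (simp add: exp_add[symmetric])
qed

lemma integral_tilted_1: "(\<integral>\<omega>. exp (u \<bullet> X \<omega> - \<psi> u) \<partial>M) = 1"
  using integral_tilted_exp[of u 0] by simp

lemma integrable_tilted:
  fixes f :: "real ^ 'n \<Rightarrow> 'v::{banach, second_countable_topology}"
  assumes [measurable]: "f \<in> borel_measurable borel"
    and le: "\<And>x. norm (f x) \<le> K * exp (c * norm x)"
  shows "integrable M (\<lambda>\<omega>. exp (u \<bullet> X \<omega> - \<psi> u) *\<^sub>R f (X \<omega>))"
proof (rule integrable_exponential_growth)
  fix x
  have "norm (exp (u \<bullet> x - \<psi> u) *\<^sub>R f x) = exp (- \<psi> u) * (exp (u \<bullet> x) * norm (f x))"
    by (simp add: exp_diff exp_minus field_simps)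
  also have "\<dots> \<le> exp (- \<psi> u) * (exp (norm u * norm x) * (K * exp (c * norm x)))"
    by (intro mult_left_mono mult_mono exp_inner_le le) auto
  also have "\<dots> = (exp (- \<psi> u) * K) * exp ((norm u + c) * norm x)"
    by (simp add: exp_add algebra_simps)
  finally show "norm (exp (u \<bullet> x - \<psi> u) *\<^sub>R f x) \<le> (exp (- \<psi> u) * K) * exp ((norm u + c) * norm x)" .
qed measurable

lemma le_exp: "t \<le> exp (t::real)"
  using exp_ge_add_one_self[of t] by linarith

lemma integrable_tilted_X: "integrable M (\<lambda>\<omega>. exp (u \<bullet> X \<omega> - \<psi> u) *\<^sub>R X \<omega>)"
  by (rule integrable_tilted[of "\<lambda>x. x" 1 1]) (use le_exp in auto)

lemma tilted_mean_inner: "(\<integral>\<omega>. exp (u \<bullet> X \<omega> - \<psi> u) * (v \<bullet> X \<omega>) \<partial>M) = v \<bullet> tilted_mean u"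
  unfolding tilted_mean_def
  by (subst integral_inner_right[symmetric]) (auto intro: integrable_tilted_X)

lemma integrable_tilted_inner: "integrable M (\<lambda>\<omega>. exp (u \<bullet> X \<omega> - \<psi> u) * (v \<bullet> X \<omega>))"
  using integrable_inner_right[OF integrable_tilted_X, of v] by simp

lemma integrable_tilted_1: "integrable M (\<lambda>\<omega>. exp (u \<bullet> X \<omega> - \<psi> u))"
  using integrable_tilted[of "\<lambda>_. 1::real" 1 0] by simp

text \<open>Jensen's inequality for the exponential under the tilted law, whose cumulant generating
  function is the increment \<open>\<psi> (u + v) - \<psi> u\<close>. The proof integrates the
  tangent of \<open>exp\<close> at the mean \<open>m\<close> of
  \<open>v \<bullet> X\<close>.\<close>

lemma cgf_tangent: "\<psi> u + v \<bullet> tilted_mean u \<le> \<psi> (u + v)"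
proof -
  define m where "m = v \<bullet> tilted_mean u"
  have int: "integrable M (\<lambda>\<omega>. exp m * ((1 - m) * exp (u \<bullet> X \<omega> - \<psi> u) + exp (u \<bullet> X \<omega> - \<psi> u) * (v \<bullet> X \<omega>)))"
    by (intro integrable_mult_right Bochner_Integration.integrable_add integrable_tilted_inner integrable_tilted_1)
  have "exp m = exp m * ((1 - m) * 1 + m)" by simp
  also have "\<dots> = (\<integral>\<omega>. exp m * ((1 - m) * exp (u \<bullet> X \<omega> - \<psi> u) + exp (u \<bullet> X \<omega> - \<psi> u) * (v \<bullet> X \<omega>)) \<partial>M)"
    unfolding integral_mult_right_zero
    by (subst Bochner_Integration.integral_add)
      (auto simp: integral_tilted_1 tilted_mean_inner integrable_tilted_inner integrable_tilted_1 m_def)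
  also have "\<dots> \<le> (\<integral>\<omega>. exp (u \<bullet> X \<omega> - \<psi> u) * exp (v \<bullet> X \<omega>) \<partial>M)"
  proof (intro integral_mono int)
    show "integrable M (\<lambda>\<omega>. exp (u \<bullet> X \<omega> - \<psi> u) * exp (v \<bullet> X \<omega>))"
      using integrable_tilted[of "\<lambda>x. exp (v \<bullet> x)" 1 "norm v" u] exp_inner_le[of v] by simp
    fix \<omega>
    have "exp m * (1 + (v \<bullet> X \<omega> - m)) \<le> exp m * exp (v \<bullet> X \<omega> - m)"
      by (intro mult_left_mono exp_ge_add_one_self) auto
    then have "exp (u \<bullet> X \<omega> - \<psi> u) * (exp m * (1 + (v \<bullet> X \<omega> - m))) \<le> exp (u \<bullet> X \<omega> - \<psi> u) * exp (v \<bullet> X \<omega>)"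
      by (intro mult_left_mono) (auto simp: exp_add[symmetric])
    then show "exp m * ((1 - m) * exp (u \<bullet> X \<omega> - \<psi> u) + exp (u \<bullet> X \<omega> - \<psi> u) * (v \<bullet> X \<omega>))
        \<le> exp (u \<bullet> X \<omega> - \<psi> u) * exp (v \<bullet> X \<omega>)"
      by (simp add: algebra_simps)
  qed
  also have "\<dots> = exp (\<psi> (u + v) - \<psi> u)" by (rule integral_tilted_exp)
  finally show ?thesis by (simp add: m_def)
qed

end

section \<open>Quadratic upper bounds and the gradient\<close>

locale semiconcave_cgf = exponential_moments M X for M :: "'a measure" and X :: "'a \<Rightarrow> real ^ 'n" +
  fixes \<delta> :: real
  assumes \<delta>_pos: "\<delta> > 0"
    and concave: "concave_on UNIV (\<lambda>u. cgf M X u - \<delta> * (norm u)\<^sup>2)"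
begin

text \<open>Concavity at the midpoint of \<open>u + v\<close> and \<open>u - v\<close>, with the
  parallelogram identity, bounds \<open>\<psi> (u + v) + \<psi> (u - v)\<close>; the second summand
  is then removed by its tangent bound. The constant is \<open>2 * \<delta>\<close> and not
  \<open>\<delta>\<close> because this route does not presuppose that \<open>\<psi>\<close> is
  differentiable.\<close>

lemma cgf_upper: "\<psi> (u + v) \<le> \<psi> u + v \<bullet> tilted_mean u + 2 * \<delta> * (norm v)\<^sup>2"
proof -
  define q where "q u = \<psi> u - \<delta> * (norm u)\<^sup>2" for u
  have "(1 - 1/2) * q (u + v) + (1/2) * q (u - v) \<le> q ((1 - 1/2) *\<^sub>R (u + v) + (1/2) *\<^sub>R (u - v))"
    using concave_onD[OF concave, of "1/2" "u + v" "u - v"] by (simp add: q_def)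
  also have "(1 - 1/2) *\<^sub>R (u + v) + (1/2) *\<^sub>R (u - v) = (1/2 :: real) *\<^sub>R ((u + v) + (u - v))"
    by (simp only: scaleR_add_right) simp
  also have "(u + v) + (u - v) = 2 *\<^sub>R u" by (simp add: scaleR_2)
  finally have "q (u + v) + q (u - v) \<le> 2 * q u" by simp
  moreover
  have "(norm (u + v))\<^sup>2 + (norm (u - v))\<^sup>2 = 2 * (norm u)\<^sup>2 + 2 * (norm v)\<^sup>2"
    by (simp add: power2_norm_eq_inner inner_simps inner_commute)
  then have "\<delta> * (norm (u + v))\<^sup>2 + \<delta> * (norm (u - v))\<^sup>2 = 2 * \<delta> * (norm u)\<^sup>2 + 2 * \<delta> * (norm v)\<^sup>2"
    by (drule_tac arg_cong[of _ _ "\<lambda>z. \<delta> * z"]) (simp add: distrib_left)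
  ultimately have "\<psi> (u + v) + \<psi> (u - v) \<le> 2 * \<psi> u + 2 * \<delta> * (norm v)\<^sup>2"
    by (simp add: q_def algebra_simps)
  moreover have "\<psi> u - v \<bullet> tilted_mean u \<le> \<psi> (u - v)"
    using cgf_tangent[of u "- v"] by simp
  ultimately show ?thesis by simp
qed

lemma GDERIV_cgf: "GDERIV \<psi> u :> tilted_mean u"
  unfolding gderiv_def has_derivative_at
proof (intro conjI bounded_linear_inner_left)
  show "(\<lambda>v. norm (\<psi> (u + v) - \<psi> u - v \<bullet> tilted_mean u) / norm v) \<midarrow>0\<rightarrow> 0"
  proof (rule Lim_null_comparison)
    show "((\<lambda>v. 2 * \<delta> * norm v) \<longlongrightarrow> 0) (at (0 :: real ^ 'n))"
      by (auto intro!: tendsto_eq_intros)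
    have "\<bar>\<psi> (u + v) - \<psi> u - v \<bullet> tilted_mean u\<bar> \<le> 2 * \<delta> * norm v * norm v" for v
      using cgf_upper[of u v] cgf_tangent[of u v] by (simp add: power2_eq_square)
    then show "\<forall>\<^sub>F v in at 0. norm (norm (\<psi> (u + v) - \<psi> u - v \<bullet> tilted_mean u) / norm v) \<le> 2 * \<delta> * norm v"
      by (auto simp: eventually_at_filter divide_le_eq)
  qed
qed

lemma gradient_cgf: "gradient \<psi> u = tilted_mean u"
  using GDERIV_cgf by (rule gradient_eqI)

text \<open>The tangent at \<open>u\<close> and the quadratic bound at \<open>w\<close> are compared
  at the same point \<open>u + v\<close>. Taking \<open>v\<close> along the difference
  \<open>d\<close> of the slopes, with length \<open>norm (u - w)\<close>, turns
  \<open>v \<bullet> d\<close> into the product of the two norms; \<open>8 * \<delta>\<close> is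
  \<open>2 * \<delta>\<close> times the square of 2, from
  \<open>norm (u - w + v) \<le> 2 * norm (u - w)\<close>.\<close>

lemma tilted_mean_lipschitz: "norm (tilted_mean u - tilted_mean w) \<le> 8 * \<delta> * norm (u - w)"
proof (cases "tilted_mean u = tilted_mean w \<or> u = w")
  case True
  then show ?thesis using \<delta>_pos by auto
next
  case False
  define d where "d = tilted_mean u - tilted_mean w"
  define v where "v = (norm (u - w) / norm d) *\<^sub>R d"
  have d0: "norm d > 0" and n0: "norm (u - w) > 0" using False by (auto simp: d_def)
  have nv: "norm v = norm (u - w)" using d0 by (simp add: v_def)
  have "\<psi> u + v \<bullet> tilted_mean u \<le> \<psi> w + (u - w + v) \<bullet> tilted_mean w + 2 * \<delta> * (norm (u - w + v))\<^sup>2"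
    using cgf_tangent[of u v] cgf_upper[of w "u - w + v"] by (simp add: algebra_simps)
  moreover have "\<psi> w + (u - w) \<bullet> tilted_mean w \<le> \<psi> u"
    using cgf_tangent[of w "u - w"] by simp
  ultimately have "v \<bullet> d \<le> 2 * \<delta> * (norm (u - w + v))\<^sup>2"
    by (simp add: d_def inner_simps)
  also have "norm (u - w + v) \<le> 2 * norm (u - w)" using norm_triangle_ineq[of "u - w" v] nv by simp
  then have "2 * \<delta> * (norm (u - w + v))\<^sup>2 \<le> 2 * \<delta> * (2 * norm (u - w))\<^sup>2"
    using \<delta>_pos by (intro mult_left_mono power_mono) auto
  also have "v \<bullet> d = norm (u - w) * norm d"
    using d0 by (simp add: v_def power2_norm_eq_inner[symmetric] power2_eq_square)
  finally have "norm (u - w) * norm d \<le> norm (u - w) * (8 * \<delta> * norm (u - w))"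
    by (simp add: power2_eq_square algebra_simps)
  then show ?thesis using n0 by (simp add: d_def)
qed

lemma continuous_tilted_mean: "continuous_on A tilted_mean"
proof -
  have "(8 * \<delta>)-lipschitz_on UNIV tilted_mean"
    using tilted_mean_lipschitz \<delta>_pos by (intro lipschitz_onI) (auto simp: dist_norm)
  from continuous_on_subset[OF lipschitz_on_continuous_on[OF this]] show ?thesis by simp
qed

lemma continuous_cgf: "continuous_on A \<psi>"
proof -
  have "isCont \<psi> u" for u
    using has_derivative_continuous[OF GDERIV_cgf[of u, unfolded gderiv_def]] .
  then show ?thesis by (simp add: continuous_at_imp_continuous_on)
qed

end

text \<open>Squaring the weak inequality at \<open>t / 2\<close> gains the term
  \<open>t^2 / 4\<close>.\<close>

lemma exp_gt_add_one:
  fixes t :: real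
  assumes "t \<noteq> 0"
  shows "1 + t < exp t"
proof (cases "1 + t / 2 > 0")
  case True
  have "1 + t < (1 + t / 2)\<^sup>2"
    using assms by (simp add: power2_sum power_divide)
  also have "\<dots> \<le> (exp (t / 2))\<^sup>2"
    using True by (intro power_mono exp_ge_add_one_self) auto
  also have "\<dots> = exp t" by (simp add: exp_double[symmetric])
  finally show ?thesis .
next
  case False
  then have "1 + t < 0" by simp
  also have "0 < exp t" by simp
  finally show ?thesis .
qed

context semiconcave_cgf
begin

text \<open>The point is that the bound is free of \<open>u\<close>. By \<open>cgf_upper\<close> the
  centered tilted law has cumulant generating function at most
  \<open>2 * \<delta> * (norm v)^2\<close>, and the sign vectors pass from linear forms to the
  norm.\<close>

lemma integral_tilted_exp_centered:
  assumes "c \<ge> 0"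
  shows "(\<integral>\<omega>. exp (u \<bullet> X \<omega> - \<psi> u) * exp (c * norm (X \<omega> - tilted_mean u)) \<partial>M)
    \<le> (\<Sum>s\<in>(sign_vectors :: (real ^ 'n) set). exp (2 * \<delta> * (norm (c *\<^sub>R s))\<^sup>2))"
proof -
  let ?D = "tilted_mean u" and ?w = "\<lambda>\<omega>. exp (u \<bullet> X \<omega> - \<psi> u)"
  have int: "integrable M (\<lambda>\<omega>. ?w \<omega> * exp (v \<bullet> (X \<omega> - ?D)))" for v
  proof -
    have "exp (v \<bullet> (x - ?D)) \<le> exp (norm v * norm ?D) * exp (norm v * norm x)" for x
    proof -
      have "v \<bullet> (x - ?D) \<le> norm v * norm (x - ?D)" by (rule norm_cauchy_schwarz)
      also have "\<dots> \<le> norm v * (norm ?D + norm x)"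
        by (intro mult_left_mono) (auto intro: order_trans[OF norm_triangle_ineq4])
      finally show ?thesis by (simp add: exp_add[symmetric] distrib_left)
    qed
    then show ?thesis
      using integrable_tilted[of "\<lambda>x. exp (v \<bullet> (x - ?D))" "exp (norm v * norm ?D)" "norm v" u] by simp
  qed
  have le: "(\<integral>\<omega>. ?w \<omega> * exp (v \<bullet> (X \<omega> - ?D)) \<partial>M) \<le> exp (2 * \<delta> * (norm v)\<^sup>2)" for v
  proof -
    have "(\<integral>\<omega>. ?w \<omega> * exp (v \<bullet> (X \<omega> - ?D)) \<partial>M) = (\<integral>\<omega>. exp (- (v \<bullet> ?D)) * (?w \<omega> * exp (v \<bullet> X \<omega>)) \<partial>M)"
      by (intro Bochner_Integration.integral_cong) (auto simp: inner_diff_right exp_diff exp_minus field_simps)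
    also have "\<dots> = exp (- (v \<bullet> ?D)) * exp (\<psi> (u + v) - \<psi> u)"
      unfolding integral_mult_right_zero integral_tilted_exp ..
    also have "\<dots> = exp (\<psi> (u + v) - \<psi> u - v \<bullet> ?D)" by (simp add: exp_add[symmetric])
    also have "\<dots> \<le> exp (2 * \<delta> * (norm v)\<^sup>2)" using cgf_upper[of u v] by simp
    finally show ?thesis .
  qed
  have "(\<integral>\<omega>. ?w \<omega> * exp (c * norm (X \<omega> - ?D)) \<partial>M)
      \<le> (\<integral>\<omega>. (\<Sum>s\<in>sign_vectors. ?w \<omega> * exp ((c *\<^sub>R s) \<bullet> (X \<omega> - ?D))) \<partial>M)"
  proof (rule Bochner_Integration.integral_mono')
    show "integrable M (\<lambda>\<omega>. \<Sum>s\<in>sign_vectors. ?w \<omega> * exp ((c *\<^sub>R s) \<bullet> (X \<omega> - ?D)))"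
      by (intro Bochner_Integration.integrable_sum int)
    show "?w \<omega> * exp (c * norm (X \<omega> - ?D)) \<le> (\<Sum>s\<in>sign_vectors. ?w \<omega> * exp ((c *\<^sub>R s) \<bullet> (X \<omega> - ?D)))" for \<omega>
      unfolding sum_distrib_left[symmetric]
      by (intro mult_left_mono exp_norm_le_sum_sign_vectors assms) simp
  qed (auto intro!: sum_nonneg)
  also have "\<dots> = (\<Sum>s\<in>sign_vectors. (\<integral>\<omega>. ?w \<omega> * exp ((c *\<^sub>R s) \<bullet> (X \<omega> - ?D)) \<partial>M))"
    by (intro Bochner_Integration.integral_sum int)
  also have "\<dots> \<le> (\<Sum>s\<in>(sign_vectors :: (real ^ 'n) set). exp (2 * \<delta> * (norm (c *\<^sub>R s))\<^sup>2))"
    by (intro sum_mono le)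
  finally show ?thesis .
qed

end

section \<open>The variance function\<close>

locale importance_sampling = semiconcave_cgf M X \<delta>
  for M :: "'a measure" and X :: "'a \<Rightarrow> real ^ 'n" and \<delta> :: real +
  fixes p F :: "real ^ 'n \<Rightarrow> real" and C lam :: real
  assumes X_density: "distributed M lborel X (\<lambda>x. ennreal (p x))"
    and p_pos: "\<And>x. p x > 0"
    and F_measurable[measurable]: "F \<in> borel_measurable borel"
    and F_nonzero: "measure M {\<omega> \<in> space M. F (X \<omega>) \<noteq> 0} > 0"
    and coercive: "filterlim (\<lambda>u. cgf M X u - 2 * cgf M X (u /\<^sub>R 2)) at_top at_infinity"
    and lam_nonneg: "lam \<ge> 0"
    and F_bound: "\<And>x. \<bar>F x\<bar> \<le> C * exp (lam / 4 * norm x)"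
begin

text \<open>Real-valued counterpart of \<open>importance_variance\<close>. The growth bound on
  \<open>F\<close> makes the integrand integrable for every parameter, so the Bochner integral is
  the true expectation.\<close>

definition V :: "real ^ 'n \<Rightarrow> real"
  where "V \<theta> = (\<integral>\<omega>. (F (X \<omega>))\<^sup>2 * exp (\<psi> \<theta> - \<theta> \<bullet> X \<omega>) \<partial>M)"

text \<open>The formal gradient of \<open>V\<close>, read off from the derivative of the integrand.
  It is used through the supporting hyperplane inequality \<open>V_tangent\<close>.\<close>

definition G :: "real ^ 'n \<Rightarrow> real ^ 'n"
  where "G \<theta> = (\<integral>\<omega>. ((F (X \<omega>))\<^sup>2 * exp (\<psi> \<theta> - \<theta> \<bullet> X \<omega>)) *\<^sub>R (tilted_mean \<theta> - X \<omega>) \<partial>M)"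

lemma F_sq_bound: "(F x)\<^sup>2 \<le> C\<^sup>2 * exp (lam / 2 * norm x)"
proof -
  have "(F x)\<^sup>2 \<le> (C * exp (lam / 4 * norm x))\<^sup>2"
    using F_bound[of x] by (metis abs_ge_zero power2_abs power_mono)
  also have "\<dots> = C\<^sup>2 * exp (lam / 2 * norm x)"
    by (simp add: power_mult_distrib exp_double[symmetric])
  finally show ?thesis .
qed

text \<open>The offset \<open>r\<close> is left free so that both the normalized weight, with
  \<open>r = \<psi> \<theta>\<close>, and the bare exponential, with \<open>r = 0\<close>, are
  covered.\<close>

lemma integrable_F_sq:
  fixes f :: "real ^ 'n \<Rightarrow> 'v::{banach, second_countable_topology}"
  assumes [measurable]: "f \<in> borel_measurable borel"
    and le: "\<And>x. norm (f x) \<le> K * exp (c * norm x)"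
  shows "integrable M (\<lambda>\<omega>. ((F (X \<omega>))\<^sup>2 * exp (r - \<theta> \<bullet> X \<omega>)) *\<^sub>R f (X \<omega>))"
proof (rule integrable_exponential_growth)
  fix x
  have "norm (((F x)\<^sup>2 * exp (r - \<theta> \<bullet> x)) *\<^sub>R f x) = (F x)\<^sup>2 * (exp r * exp ((- \<theta>) \<bullet> x)) * norm (f x)"
    by (simp add: exp_diff exp_minus field_simps)
  also have "\<dots> \<le> (C\<^sup>2 * exp (lam / 2 * norm x)) * (exp r * exp (norm (- \<theta>) * norm x)) * (K * exp (c * norm x))"
    by (intro mult_mono mult_left_mono F_sq_bound exp_inner_le le) auto
  also have "\<dots> = (C\<^sup>2 * exp r * K) * exp ((lam / 2 + norm \<theta> + c) * norm x)"
    by (simp add: exp_add algebra_simps)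
  finally show "norm (((F x)\<^sup>2 * exp (r - \<theta> \<bullet> x)) *\<^sub>R f x)
    \<le> (C\<^sup>2 * exp r * K) * exp ((lam / 2 + norm \<theta> + c) * norm x)" .
qed measurable

lemma integrable_V: "integrable M (\<lambda>\<omega>. (F (X \<omega>))\<^sup>2 * exp (r - \<theta> \<bullet> X \<omega>))"
  using integrable_F_sq[of "\<lambda>_. 1::real" 1 0] by simp

lemma integrable_G: "integrable M (\<lambda>\<omega>. ((F (X \<omega>))\<^sup>2 * exp (r - \<theta> \<bullet> X \<omega>)) *\<^sub>R (c - X \<omega>))"
proof (rule integrable_F_sq[of "\<lambda>x. c - x" "norm c + 1" 1])
  fix x :: "real ^ 'n"
  have "norm (c - x) \<le> norm c + norm x" by (rule norm_triangle_ineq4)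
  also have "\<dots> \<le> norm c * exp (1 * norm x) + exp (1 * norm x)"
    using le_exp[of "norm x"] by (intro add_mono) (auto simp: mult_le_cancel_left1)
  finally show "norm (c - x) \<le> (norm c + 1) * exp (1 * norm x)" by (simp add: algebra_simps)
qed measurable

lemma importance_variance_eq: "importance_variance M X p F \<theta> = ennreal (V \<theta>)"
proof -
  have "p x / esscher_density M X p \<theta> x = exp (\<psi> \<theta> - \<theta> \<bullet> x)" for x
    using p_pos[of x] by (simp add: esscher_density_def exp_diff field_simps)
  then show ?thesis
    unfolding importance_variance_def V_def
    by (simp add: nn_integral_eq_integral integrable_V)
qed

lemma V_nonneg: "V \<theta> \<ge> 0"
  unfolding V_def by (intro Bochner_Integration.integral_nonneg) simp

section \<open>Strict convexity, coercivity and the unique minimizer of the variance\<close>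

lemma AE_not_hyperplane:
  assumes "v \<noteq> 0"
  shows "AE \<omega> in M. v \<bullet> X \<omega> \<noteq> c"
proof (rule AE_I')
  let ?A = "{x :: real ^ 'n. v \<bullet> x = c}"
  have A: "?A \<in> sets borel" by measurable
  have "negligible ?A" using assms by (intro negligible_hyperplane) simp
  then have "?A \<in> null_sets lborel"
    using A by (simp add: negligible_iff_null_sets null_sets_completion_iff)
  then have "emeasure M (X -` ?A \<inter> space M) = 0"
    using distributed_emeasure[OF X_density, of ?A] A by (simp add: nn_integral_null_set)
  then show "X -` ?A \<inter> space M \<in> null_sets M"
    using A measurable_sets[OF X_measurable] by (intro null_setsI) auto
qed auto

text \<open>The gap between the two sides is the mean of \<open>d (X \<omega>)\<close>. Pointwise
  \<open>d\<close> is nonnegative, by \<open>cgf_tangent\<close> followed by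
  \<open>1 + t \<le> exp t\<close>, and it vanishes only where \<open>F\<close> does or on the
  hyperplane where \<open>t x = 0\<close>. A zero mean would therefore make
  \<open>F (X \<omega>)\<close> vanish almost surely.\<close>

lemma V_strict_tangent:
  assumes "\<eta> \<noteq> \<theta>"
  shows "V \<theta> + (\<eta> - \<theta>) \<bullet> G \<theta> < V \<eta>"
proof -
  define A where "A x = exp (\<psi> \<theta> - \<theta> \<bullet> x)" for x
  define t where "t x = (\<eta> - \<theta>) \<bullet> (tilted_mean \<theta> - x)" for x
  define d where "d x = (F x)\<^sup>2 * (exp (\<psi> \<eta> - \<eta> \<bullet> x) - A x * (1 + t x))" for x
  have Aexp: "A x * exp (t x) \<le> exp (\<psi> \<eta> - \<eta> \<bullet> x)" for x
    using cgf_tangent[of \<theta> "\<eta> - \<theta>"]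
    by (simp add: A_def t_def exp_add[symmetric] inner_diff_right inner_diff_left)
  have A0: "A x > 0" for x by (simp add: A_def)
  have dA: "A x * (1 + t x) \<le> A x * exp (t x)" for x
    using A0[of x] by (intro mult_left_mono exp_ge_add_one_self) auto
  have d0: "d x \<ge> 0" for x
    unfolding d_def using Aexp[of x] dA[of x] by (intro mult_nonneg_nonneg) auto
  have d_zero: "F x = 0 \<or> t x = 0" if "d x = 0" for x
  proof (rule ccontr)
    assume "\<not> ?thesis"
    then have F: "(F x)\<^sup>2 > 0" and "t x \<noteq> 0" by auto
    then have "1 + t x < exp (t x)"
      by (intro exp_gt_add_one)
    then have "A x * (1 + t x) < A x * exp (t x)" using A0[of x] by simp
    then have "d x > 0" unfolding d_def using F Aexp[of x] by (intro mult_pos_pos) auto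
    with that show False by simp
  qed
  have d_eq: "d (X \<omega>) = (F (X \<omega>))\<^sup>2 * exp (\<psi> \<eta> - \<eta> \<bullet> X \<omega>) - ((F (X \<omega>))\<^sup>2 * exp (\<psi> \<theta> - \<theta> \<bullet> X \<omega>)
      + (\<eta> - \<theta>) \<bullet> (((F (X \<omega>))\<^sup>2 * exp (\<psi> \<theta> - \<theta> \<bullet> X \<omega>)) *\<^sub>R (tilted_mean \<theta> - X \<omega>)))" for \<omega>
    by (simp add: d_def A_def t_def algebra_simps)
  have int: "integrable M (\<lambda>\<omega>. d (X \<omega>))"
    unfolding d_eq by (intro Bochner_Integration.integrable_diff Bochner_Integration.integrable_add integrable_V
      integrable_inner_right integrable_G)
  have "(\<integral>\<omega>. d (X \<omega>) \<partial>M) = V \<eta> - (V \<theta> + (\<eta> - \<theta>) \<bullet> G \<theta>)"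
    unfolding d_eq V_def G_def
    by (simp add: integrable_V integrable_G Bochner_Integration.integral_diff Bochner_Integration.integral_add
        integral_inner_right integrable_inner_right del: inner_scaleR_right)
  moreover have "(\<integral>\<omega>. d (X \<omega>) \<partial>M) \<ge> 0" by (intro Bochner_Integration.integral_nonneg d0)
  moreover have "(\<integral>\<omega>. d (X \<omega>) \<partial>M) \<noteq> 0"
  proof
    assume "(\<integral>\<omega>. d (X \<omega>) \<partial>M) = 0"
    then have "AE \<omega> in M. d (X \<omega>) = 0"
      using integral_nonneg_eq_0_iff_AE[OF int] d0 by simp
    moreover have "AE \<omega> in M. (\<eta> - \<theta>) \<bullet> X \<omega> \<noteq> (\<eta> - \<theta>) \<bullet> tilted_mean \<theta>"
      using assms by (intro AE_not_hyperplane) simp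
    ultimately have "AE \<omega> in M. \<not> F (X \<omega>) \<noteq> 0"
    proof eventually_elim
      case (elim \<omega>)
      then show ?case using d_zero[of "X \<omega>"] by (auto simp: t_def inner_diff_right)
    qed
    then have "prob {\<omega> \<in> space M. F (X \<omega>) \<noteq> 0} = 0" by (subst prob_eq_0) auto
    with F_nonzero show False by simp
  qed
  ultimately show ?thesis by linarith
qed

lemma V_tangent: "V \<theta> + (\<eta> - \<theta>) \<bullet> G \<theta> \<le> V \<eta>"
  using V_strict_tangent[of \<eta> \<theta>] by (cases "\<eta> = \<theta>") auto

lemma convex_V: "convex_on UNIV V"
proof (rule convex_onI)
  fix t :: real and x y :: "real ^ 'n" assume t: "0 < t" "t < 1"
  let ?m = "(1 - t) *\<^sub>R x + t *\<^sub>R y"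
  have "(1 - t) * (V ?m + (x - ?m) \<bullet> G ?m) + t * (V ?m + (y - ?m) \<bullet> G ?m) \<le> (1 - t) * V x + t * V y"
    using t by (intro add_mono mult_left_mono V_tangent) auto
  then show "V ?m \<le> (1 - t) * V x + t * V y"
    by (simp add: inner_simps algebra_simps)
qed simp

lemma continuous_V: "continuous_on A V"
  by (rule continuous_on_subset[OF convex_on_continuous[OF open_UNIV convex_V]]) simp

text \<open>This produces the combination of \<open>\<psi>\<close> that occurs in
  \<open>coercive\<close>: \<open>exp (\<psi> \<theta>)\<close> factors out of \<open>V\<close>, and
  what remains is a mean of \<open>F^2 / y^2\<close>, where \<open>y\<close> has mean
  \<open>exp (\<psi> (\<theta> /\<^sub>R 2))\<close>.\<close>

lemma V_lower_bound:
  assumes "\<epsilon> > 0"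
  defines "k \<equiv> prob {\<omega> \<in> space M. \<bar>F (X \<omega>)\<bar> \<ge> \<epsilon>}"
  shows "k ^ 3 * \<epsilon>\<^sup>2 / 8 * exp (\<psi> \<theta> - 2 * \<psi> (\<theta> /\<^sub>R 2)) \<le> V \<theta>"
proof (cases "k = 0")
  case True
  then show ?thesis using V_nonneg by simp
next
  case False
  then have k: "k > 0" unfolding k_def using zero_less_measure_iff by blast
  define A where "A = {\<omega> \<in> space M. \<bar>F (X \<omega>)\<bar> \<ge> \<epsilon>}"
  have [measurable]: "A \<in> sets M" unfolding A_def by measurable
  define y where "y \<omega> = exp ((\<theta> /\<^sub>R 2) \<bullet> X \<omega>)" for \<omega>
  \<comment> \<open>A reverse Hoelder inequality obtained by integrating \<open>1 \<le> t\<^sup>2 / y\<^sup>2 + y / t\<close> over \<open>A\<close>;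
    this \<open>t\<close> makes the second term contribute at most \<open>k / 2\<close>.\<close>
  define t where "t = 2 * exp (\<psi> (\<theta> /\<^sub>R 2)) / k"
  have t0: "t > 0" using k by (simp add: t_def)
  have y0: "y \<omega> > 0" for \<omega> by (simp add: y_def)
  have ysq: "1 / (y \<omega>)\<^sup>2 = exp (0 - \<theta> \<bullet> X \<omega>)" for \<omega>
    by (simp add: y_def exp_double[symmetric] exp_minus inverse_eq_divide)
  define V0 where "V0 = (\<integral>\<omega>. (F (X \<omega>))\<^sup>2 * exp (0 - \<theta> \<bullet> X \<omega>) \<partial>M)"
  have V: "V \<theta> = exp (\<psi> \<theta>) * V0"
    unfolding V_def V0_def integral_mult_right_zero[symmetric]
    by (intro Bochner_Integration.integral_cong) (auto simp: exp_diff exp_minus field_simps)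
  have "k = (\<integral>\<omega>. indicator A \<omega> \<partial>M)" by (simp add: k_def A_def)
  also have "\<dots> \<le> (\<integral>\<omega>. t\<^sup>2 / \<epsilon>\<^sup>2 * ((F (X \<omega>))\<^sup>2 * exp (0 - \<theta> \<bullet> X \<omega>)) + 1 / t * y \<omega> \<partial>M)"
  proof (rule Bochner_Integration.integral_mono)
    show "integrable M (\<lambda>\<omega>. t\<^sup>2 / \<epsilon>\<^sup>2 * ((F (X \<omega>))\<^sup>2 * exp (0 - \<theta> \<bullet> X \<omega>)) + 1 / t * y \<omega>)"
      unfolding y_def
      by (intro Bochner_Integration.integrable_add integrable_mult_right integrable_V integrable_exp_inner)
    fix \<omega>
    show "indicator A \<omega> \<le> t\<^sup>2 / \<epsilon>\<^sup>2 * ((F (X \<omega>))\<^sup>2 * exp (0 - \<theta> \<bullet> X \<omega>)) + 1 / t * y \<omega>"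
    proof (cases "\<omega> \<in> A")
      case True
      then have "\<epsilon>\<^sup>2 \<le> (F (X \<omega>))\<^sup>2" using assms(1) abs_le_square_iff[of \<epsilon> "F (X \<omega>)"] by (simp add: A_def)
      then have f1: "(F (X \<omega>))\<^sup>2 / \<epsilon>\<^sup>2 \<ge> 1" using assms(1) by (simp add: le_divide_eq)
      \<comment> \<open>One of the two summands alone is at least 1, according to whether
        \<open>y \<omega>\<close> is below or above \<open>t\<close>.\<close>
      have "1 \<le> t\<^sup>2 / (y \<omega>)\<^sup>2 + y \<omega> / t"
      proof (cases "y \<omega> \<le> t")
        case True
        then have "1 \<le> (t / y \<omega>)\<^sup>2" using y0[of \<omega>] by (intro one_le_power) simp
        then show ?thesis using y0[of \<omega>] t0 by (simp add: power_divide add_increasing2)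
      next
        case False
        then show ?thesis using y0[of \<omega>] t0 by (simp add: add_increasing le_divide_eq)
      qed
      also have "t\<^sup>2 / (y \<omega>)\<^sup>2 \<le> (t\<^sup>2 / (y \<omega>)\<^sup>2) * ((F (X \<omega>))\<^sup>2 / \<epsilon>\<^sup>2)"
        using mult_left_mono[OF f1, of "t\<^sup>2 / (y \<omega>)\<^sup>2"] by simp
      also have "\<dots> = t\<^sup>2 / \<epsilon>\<^sup>2 * ((F (X \<omega>))\<^sup>2 * exp (0 - \<theta> \<bullet> X \<omega>))"
        unfolding ysq[symmetric] by simp
      finally show ?thesis using True by simp
    next
      case False
      then show ?thesis using t0 y0[of \<omega>] by (auto intro!: add_nonneg_nonneg mult_nonneg_nonneg less_imp_le)
    qed
  qed (auto intro!: integrable_real_indicator simp: less_top[symmetric])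
  also have "\<dots> = t\<^sup>2 / \<epsilon>\<^sup>2 * V0 + 1 / t * exp (\<psi> (\<theta> /\<^sub>R 2))"
    unfolding V0_def y_def exp_cgf integral_mult_right_zero[symmetric]
    by (intro Bochner_Integration.integral_add integrable_mult_right integrable_V integrable_exp_inner)
  also have "1 / t * exp (\<psi> (\<theta> /\<^sub>R 2)) = k / 2" by (simp add: t_def)
  also have "t\<^sup>2 / \<epsilon>\<^sup>2 * V0 = 4 / (k\<^sup>2 * \<epsilon>\<^sup>2) * (exp (2 * \<psi> (\<theta> /\<^sub>R 2)) * V0)"
    by (simp add: t_def power_divide power_mult_distrib exp_double[symmetric])
  finally have "k / 2 \<le> 4 / (k\<^sup>2 * \<epsilon>\<^sup>2) * (exp (2 * \<psi> (\<theta> /\<^sub>R 2)) * V0)" by simp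
  \<comment> \<open>Solving for \<open>V0\<close>. The final 1/8 is the 1/2 of the remaining
    \<open>k / 2\<close> times the 1/4 that inverts the square of the 2 in \<open>t\<close>.\<close>
  then have "(k\<^sup>2 * \<epsilon>\<^sup>2 / 4) * (k / 2) \<le> (k\<^sup>2 * \<epsilon>\<^sup>2 / 4) * (4 / (k\<^sup>2 * \<epsilon>\<^sup>2) * (exp (2 * \<psi> (\<theta> /\<^sub>R 2)) * V0))"
    by (intro mult_left_mono) auto
  also have "\<dots> = exp (2 * \<psi> (\<theta> /\<^sub>R 2)) * V0" using k assms(1) by simp
  finally have "k ^ 3 * \<epsilon>\<^sup>2 / 8 \<le> exp (2 * \<psi> (\<theta> /\<^sub>R 2)) * V0"
    by (simp add: power2_eq_square power3_eq_cube algebra_simps)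
  then have "k ^ 3 * \<epsilon>\<^sup>2 / 8 * exp (\<psi> \<theta> - 2 * \<psi> (\<theta> /\<^sub>R 2)) \<le> exp (2 * \<psi> (\<theta> /\<^sub>R 2)) * V0 * exp (\<psi> \<theta> - 2 * \<psi> (\<theta> /\<^sub>R 2))"
    by (intro mult_right_mono) auto
  also have "\<dots> = V \<theta>" by (simp add: V exp_diff)
  finally show ?thesis .
qed

lemma V_coercive: "filterlim V at_top at_infinity"
proof -
  \<comment> \<open>If no such level existed, the events with thresholds \<open>1 / (n + 1)\<close>
    would all be null, and so would their union, where
    \<open>F (X \<omega>) \<noteq> 0\<close>.\<close>
  obtain \<epsilon> where \<epsilon>: "\<epsilon> > 0" "prob {\<omega> \<in> space M. \<bar>F (X \<omega>)\<bar> \<ge> \<epsilon>} > 0"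
  proof (rule ccontr)
    assume "\<not> thesis"
    then have "prob {\<omega> \<in> space M. \<bar>F (X \<omega>)\<bar> \<ge> inverse (real (Suc n))} = 0" for n
      using that[of "inverse (real (Suc n))"] zero_less_measure_iff by auto
    then have "AE \<omega> in M. \<not> \<bar>F (X \<omega>)\<bar> \<ge> inverse (real (Suc n))" for n
      by (subst (asm) prob_eq_0) auto
    then have "AE \<omega> in M. \<forall>n. \<not> \<bar>F (X \<omega>)\<bar> \<ge> inverse (real (Suc n))"
      by (simp add: AE_all_countable)
    then have "AE \<omega> in M. \<not> F (X \<omega>) \<noteq> 0"
    proof eventually_elim
      case (elim \<omega>)
      show ?case
      proof
        assume "F (X \<omega>) \<noteq> 0"
        then obtain n where "inverse (real (Suc n)) < \<bar>F (X \<omega>)\<bar>" using reals_Archimedean[of "\<bar>F (X \<omega>)\<bar>"] by auto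
        with elim show False by (auto simp: less_le)
      qed
    qed
    then have "prob {\<omega> \<in> space M. F (X \<omega>) \<noteq> 0} = 0" by (subst prob_eq_0) auto
    with F_nonzero show False by simp
  qed
  let ?c = "prob {\<omega> \<in> space M. \<bar>F (X \<omega>)\<bar> \<ge> \<epsilon>} ^ 3 * \<epsilon>\<^sup>2 / 8"
  have "?c > 0" using \<epsilon> by simp
  then have "filterlim (\<lambda>\<theta>. ?c * exp (\<psi> \<theta> - 2 * \<psi> (\<theta> /\<^sub>R 2))) at_top at_infinity"
    by (intro filterlim_tendsto_pos_mult_at_top[OF tendsto_const]
        filterlim_compose[OF exp_at_top coercive])
  then show ?thesis
    by (rule filterlim_at_top_mono) (use V_lower_bound[OF \<epsilon>(1)] in auto)
qed

lemma V_minimizer: "\<exists>\<theta>s. \<forall>\<theta>. \<theta> \<noteq> \<theta>s \<longrightarrow> V \<theta>s < V \<theta>"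
proof -
  obtain R where R: "\<And>\<theta>. norm \<theta> \<ge> R \<Longrightarrow> V \<theta> \<ge> V 0"
    using V_coercive unfolding filterlim_at_top eventually_at_infinity by meson
  \<comment> \<open>The absolute value keeps 0 in the ball even if \<open>R\<close> is negative;
    outside the ball \<open>V\<close> is at least \<open>V 0\<close>.\<close>
  have "\<exists>x\<in>cball 0 \<bar>R\<bar>. \<forall>y\<in>cball 0 \<bar>R\<bar>. V x \<le> V y"
    by (intro continuous_attains_inf continuous_V) auto
  then obtain m where "\<forall>y\<in>cball 0 \<bar>R\<bar>. V m \<le> V y" by blast
  then have m: "V m \<le> V y" if "norm y \<le> \<bar>R\<bar>" for y using that by simp
  have min: "V m \<le> V y" for y
  proof (cases "norm y \<le> \<bar>R\<bar>")
    case False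
    then have "V 0 \<le> V y" by (intro R) auto
    with m[of 0] show ?thesis by simp
  qed (use m in auto)
  have "V m < V y" if "y \<noteq> m" for y
  proof -
    \<comment> \<open>Supporting hyperplanes at the midpoint: the linear terms toward
      \<open>y\<close> and \<open>m\<close> are opposite and cancel in the sum.\<close>
    let ?z = "(1/2) *\<^sub>R (m + y)"
    have yz: "y - ?z = (1/2) *\<^sub>R (y - m)" "m - ?z = - ((1/2) *\<^sub>R (y - m))"
      by (auto simp: vec_eq_iff field_simps)
    have "V ?z + (y - ?z) \<bullet> G ?z < V y"
      using that yz(1) by (intro V_strict_tangent) auto
    moreover have "V ?z + (m - ?z) \<bullet> G ?z \<le> V m" by (rule V_tangent)
    ultimately have "2 * V ?z < V y + V m" unfolding yz by simp
    with min[of ?z] show ?thesis by simp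
  qed
  then show ?thesis by blast
qed

end

section \<open>One step of the recursion\<close>

lemma square_add_le: "(a + b)\<^sup>2 \<le> 2 * a\<^sup>2 + 2 * b\<^sup>2" for a b :: real
  using sum_squares_bound[of a b] by (simp add: power2_sum)

context importance_sampling
begin

section \<open>Second moment of the update\<close>

lemma update_field_eq:
  "update_field M X F lam \<theta> x
    = (exp (- (lam / 2 * sqrt (real CARD('n)) * norm (tilted_mean (- \<theta>)))) * (F x)\<^sup>2) *\<^sub>R (tilted_mean \<theta> - x)"
  by (simp add: update_field_def gradient_cgf)

lemma tilted_mean_measurable[measurable]: "tilted_mean \<in> borel_measurable borel"
  using continuous_tilted_mean by (rule borel_measurable_continuous_onI)

lemma update_field_measurable[measurable]:
  "(\<lambda>(\<theta>, x). update_field M X F lam \<theta> x) \<in> borel_measurable (borel \<Otimes>\<^sub>M borel)"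
  unfolding update_field_eq by measurable

text \<open>The factor \<open>4 * C ^ 4\<close> comes from \<open>norm_update_field_le\<close>; the
  sum is the bound of \<open>integral_tilted_exp_centered\<close> at rate
  \<open>lam + 1\<close>.\<close>

definition second_moment_const :: real
  where "second_moment_const = 4 * C ^ 4 *
    (\<Sum>s\<in>(sign_vectors :: (real ^ 'n) set). exp (2 * \<delta> * (norm ((lam + 1) *\<^sub>R s))\<^sup>2))"

lemma second_moment_const_nonneg: "second_moment_const \<ge> 0"
  unfolding second_moment_const_def by (intro mult_nonneg_nonneg sum_nonneg) auto

text \<open>Let \<open>a = tilted_mean (- \<theta>)\<close>, the mean of the sampling law, and
  \<open>y = norm (x - a)\<close>. The square root of the dimension is at least 1, so the squared
  damping cancels the part of \<open>exp (lam * norm x)\<close> due to \<open>a\<close> and leaves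
  \<open>exp (lam * y)\<close>. The displacement is at most
  \<open>16 * \<delta> * norm \<theta> + y\<close>, by the Lipschitz bound over the distance
  \<open>2 * norm \<theta>\<close>. The extra 1 in \<open>lam + 1\<close> pays for
  \<open>1 + y^2 \<le> 2 * exp y\<close>.\<close>

lemma norm_update_field_le:
  "(norm (update_field M X F lam \<theta> x))\<^sup>2
    \<le> 4 * C ^ 4 * (1 + (16 * \<delta> * norm \<theta>)\<^sup>2) * exp ((lam + 1) * norm (x - tilted_mean (- \<theta>)))"
proof -
  let ?a = "tilted_mean (- \<theta>)"
  define y where "y = norm (x - ?a)"
  define k where "k = sqrt (real CARD('n))"
  have y0: "y \<ge> 0" by (simp add: y_def)
  have "k \<ge> 1" by (simp add: k_def Suc_leI)
  have F4: "(F x)^4 \<le> C^4 * exp (lam * norm x)"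
  proof -
    have "((F x)\<^sup>2)\<^sup>2 \<le> (C\<^sup>2 * exp (lam / 2 * norm x))\<^sup>2"
      by (intro power_mono F_sq_bound) auto
    also have "\<dots> = C^4 * exp (lam * norm x)"
      by (simp add: power_mult_distrib exp_double[symmetric])
    finally show ?thesis by simp
  qed
  have nx: "norm x \<le> k * norm ?a + y"
  proof -
    have "norm x \<le> norm ?a + y" using norm_triangle_ineq[of ?a "x - ?a"] by (simp add: y_def)
    also have "norm ?a \<le> k * norm ?a" using mult_right_mono[OF \<open>k \<ge> 1\<close>, of "norm ?a"] by simp
    finally show ?thesis by simp
  qed
  have dist: "norm (tilted_mean \<theta> - x) \<le> 16 * \<delta> * norm \<theta> + y"
  proof -
    have "norm (tilted_mean \<theta> - x) \<le> norm (tilted_mean \<theta> - ?a) + y"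
      using norm_triangle_ineq[of "tilted_mean \<theta> - ?a" "?a - x"] by (simp add: y_def norm_minus_commute)
    also have "norm (tilted_mean \<theta> - ?a) \<le> 8 * \<delta> * norm (\<theta> - - \<theta>)" by (rule tilted_mean_lipschitz)
    also have "norm (\<theta> - - \<theta>) = 2 * norm \<theta>" by (simp add: scaleR_2[symmetric])
    finally show ?thesis by simp
  qed
  have dist2: "(norm (tilted_mean \<theta> - x))\<^sup>2 \<le> 4 * (1 + (16 * \<delta> * norm \<theta>)\<^sup>2) * exp y"
  proof -
    let ?r = "16 * \<delta> * norm \<theta>"
    have "(norm (tilted_mean \<theta> - x))\<^sup>2 \<le> (?r + y)\<^sup>2" by (intro power_mono dist) simp
    also have "\<dots> \<le> 2 * (1 + ?r\<^sup>2) * (1 + y\<^sup>2)"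
    proof -
      have "(?r + y)\<^sup>2 \<le> 2 * ?r\<^sup>2 + 2 * y\<^sup>2" by (rule square_add_le)
      also have "\<dots> \<le> 2 * (1 + ?r\<^sup>2) * (1 + y\<^sup>2)" by (simp add: algebra_simps)
      finally show ?thesis .
    qed
    also have "\<dots> \<le> 2 * (1 + ?r\<^sup>2) * (2 * exp y)"
      using exp_lower_Taylor_quadratic[OF y0] y0 by (intro mult_left_mono) auto
    finally show ?thesis by (simp add: algebra_simps)
  qed
  have "(norm (update_field M X F lam \<theta> x))\<^sup>2
      = exp (- (lam * k * norm ?a)) * ((F x)^4 * (norm (tilted_mean \<theta> - x))\<^sup>2)"
    unfolding update_field_eq k_def[symmetric]
    by (simp add: power_mult_distrib exp_double[symmetric])
  also have "\<dots> \<le> exp (- (lam * k * norm ?a))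
      * ((C^4 * exp (lam * (k * norm ?a + y))) * (4 * (1 + (16 * \<delta> * norm \<theta>)\<^sup>2) * exp y))"
  proof (intro mult_left_mono mult_mono dist2)
    have "C^4 * exp (lam * norm x) \<le> C^4 * exp (lam * (k * norm ?a + y))"
      using nx lam_nonneg by (intro mult_left_mono) (auto intro: mult_left_mono)
    with F4 show "(F x)^4 \<le> C^4 * exp (lam * (k * norm ?a + y))" by linarith
  qed auto
  also have "\<dots> = 4 * C ^ 4 * (1 + (16 * \<delta> * norm \<theta>)\<^sup>2)
      * (exp (- (lam * k * norm ?a)) * exp (lam * (k * norm ?a + y)) * exp y)"
    by (simp only: ac_simps)
  also have "exp (- (lam * k * norm ?a)) * exp (lam * (k * norm ?a + y)) * exp y = exp ((lam + 1) * y)"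
    by (simp add: exp_add[symmetric] algebra_simps)
  finally show ?thesis by (simp add: y_def)
qed

lemma integrable_tilted_exp_centered:
  "integrable M (\<lambda>\<omega>. exp (u \<bullet> X \<omega> - \<psi> u) * exp (\<bar>c\<bar> * norm (X \<omega> - a)))"
proof -
  have "exp (\<bar>c\<bar> * norm (x - a)) \<le> exp (\<bar>c\<bar> * norm a) * exp (\<bar>c\<bar> * norm x)" for x
  proof -
    have "\<bar>c\<bar> * norm (x - a) \<le> \<bar>c\<bar> * (norm x + norm a)"
      by (intro mult_left_mono norm_triangle_ineq4) auto
    then show ?thesis by (simp add: exp_add[symmetric] algebra_simps)
  qed
  then show ?thesis
    using integrable_tilted[of "\<lambda>x. exp (\<bar>c\<bar> * norm (x - a))" "exp (\<bar>c\<bar> * norm a)" "\<bar>c\<bar>" u] by simp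
qed

lemma
  shows integrable_update_field_sq:
    "integrable M (\<lambda>\<omega>. exp ((- \<theta>) \<bullet> X \<omega> - \<psi> (- \<theta>)) * (norm (update_field M X F lam \<theta> (X \<omega>)))\<^sup>2)" (is ?int)
    and update_field_sq_le:
    "(\<integral>\<omega>. exp ((- \<theta>) \<bullet> X \<omega> - \<psi> (- \<theta>)) * (norm (update_field M X F lam \<theta> (X \<omega>)))\<^sup>2 \<partial>M)
      \<le> second_moment_const * (1 + (16 * \<delta> * norm \<theta>)\<^sup>2)" (is ?le)
proof -
  let ?w = "\<lambda>\<omega>. exp ((- \<theta>) \<bullet> X \<omega> - \<psi> (- \<theta>))"
  let ?e = "\<lambda>\<omega>. exp ((lam + 1) * norm (X \<omega> - tilted_mean (- \<theta>)))"
  let ?k = "4 * C ^ 4 * (1 + (16 * \<delta> * norm \<theta>)\<^sup>2)"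
  have le: "?w \<omega> * (norm (update_field M X F lam \<theta> (X \<omega>)))\<^sup>2 \<le> ?k * (?w \<omega> * ?e \<omega>)" for \<omega>
    using mult_left_mono[OF norm_update_field_le[of \<theta> "X \<omega>"], of "?w \<omega>"] by (simp only: ac_simps) simp
  have int: "integrable M (\<lambda>\<omega>. ?k * (?w \<omega> * ?e \<omega>))"
    using integrable_tilted_exp_centered[of "- \<theta>" "lam + 1" "tilted_mean (- \<theta>)"] lam_nonneg
    by (intro integrable_mult_right) simp
  show ?int
  proof (rule Bochner_Integration.integrable_bound[OF int])
    show "AE \<omega> in M. norm (?w \<omega> * (norm (update_field M X F lam \<theta> (X \<omega>)))\<^sup>2) \<le> norm (?k * (?w \<omega> * ?e \<omega>))"
      using order_trans[OF le abs_ge_self] by (intro AE_I2) simp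
    have "update_field M X F lam \<theta> \<in> borel_measurable borel"
      unfolding update_field_eq by measurable
    note [measurable] = this
    show "(\<lambda>\<omega>. ?w \<omega> * (norm (update_field M X F lam \<theta> (X \<omega>)))\<^sup>2) \<in> borel_measurable M" by measurable
  qed
  then have "(\<integral>\<omega>. ?w \<omega> * (norm (update_field M X F lam \<theta> (X \<omega>)))\<^sup>2 \<partial>M) \<le> (\<integral>\<omega>. ?k * (?w \<omega> * ?e \<omega>) \<partial>M)"
    by (intro Bochner_Integration.integral_mono int le)
  also have "\<dots> = ?k * (\<integral>\<omega>. ?w \<omega> * ?e \<omega> \<partial>M)" by (rule integral_mult_right_zero)
  also have "\<dots> \<le> ?k * (\<Sum>s\<in>(sign_vectors :: (real ^ 'n) set). exp (2 * \<delta> * (norm ((lam + 1) *\<^sub>R s))\<^sup>2))"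
    using lam_nonneg by (intro mult_left_mono integral_tilted_exp_centered) auto
  also have "\<dots> = second_moment_const * (1 + (16 * \<delta> * norm \<theta>)\<^sup>2)"
    by (simp add: second_moment_const_def)
  finally show ?le .
qed

text \<open>Ratio between the mean update under the law with parameter \<open>- \<theta>\<close> and
  \<open>G \<theta>\<close>: the damping factor times the two normalizations, that of the sampling
  law and the one contained in \<open>V\<close>.\<close>

definition weight :: "real ^ 'n \<Rightarrow> real"
  where "weight \<theta> = exp (- (lam / 2 * sqrt (real CARD('n)) * norm (tilted_mean (- \<theta>))) - \<psi> (- \<theta>) - \<psi> \<theta>)"

lemma weight_pos: "weight \<theta> > 0" by (simp add: weight_def)

lemma continuous_weight: "continuous_on A weight"
  unfolding weight_def
  by (intro continuous_intros continuous_on_compose2[OF continuous_tilted_mean[of UNIV]]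
      continuous_on_compose2[OF continuous_cgf[of UNIV]]) auto

lemma
  shows integrable_update_field:
    "integrable M (\<lambda>\<omega>. exp ((- \<theta>) \<bullet> X \<omega> - \<psi> (- \<theta>)) *\<^sub>R update_field M X F lam \<theta> (X \<omega>))" (is ?int)
    and mean_update_field:
    "(\<integral>\<omega>. exp ((- \<theta>) \<bullet> X \<omega> - \<psi> (- \<theta>)) *\<^sub>R update_field M X F lam \<theta> (X \<omega>) \<partial>M) = weight \<theta> *\<^sub>R G \<theta>" (is ?eq)
proof -
  have eq: "exp ((- \<theta>) \<bullet> X \<omega> - \<psi> (- \<theta>)) *\<^sub>R update_field M X F lam \<theta> (X \<omega>)
      = weight \<theta> *\<^sub>R (((F (X \<omega>))\<^sup>2 * exp (\<psi> \<theta> - \<theta> \<bullet> X \<omega>)) *\<^sub>R (tilted_mean \<theta> - X \<omega>))" for \<omega>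
  proof -
    have "exp ((- \<theta>) \<bullet> X \<omega> - \<psi> (- \<theta>)) * exp (- (lam / 2 * sqrt (real CARD('n)) * norm (tilted_mean (- \<theta>))))
        = weight \<theta> * exp (\<psi> \<theta> - \<theta> \<bullet> X \<omega>)"
      by (simp add: weight_def exp_add[symmetric])
    then have "exp ((- \<theta>) \<bullet> X \<omega> - \<psi> (- \<theta>)) * (exp (- (lam / 2 * sqrt (real CARD('n)) * norm (tilted_mean (- \<theta>)))) * (F (X \<omega>))\<^sup>2)
        = weight \<theta> * ((F (X \<omega>))\<^sup>2 * exp (\<psi> \<theta> - \<theta> \<bullet> X \<omega>))"
      by (simp only: mult.assoc[symmetric]) (simp add: mult.commute mult.left_commute)
    then show ?thesis by (simp only: update_field_eq scaleR_scaleR)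
  qed
  show ?int unfolding eq by (intro integrable_scaleR_right integrable_G)
  show ?eq unfolding eq G_def by (rule integral_scaleR_right)
qed

text \<open>The square is expanded under the tilted law. The sign of \<open>L\<close> is recorded as
  well because \<open>ennreal\<close> sends negative reals to 0, and \<open>L\<close> is later added
  to other terms inside \<open>ennreal\<close>.\<close>

lemma
  fixes \<theta>s :: "real ^ 'n" and \<gamma> :: real
  defines "L \<equiv> \<lambda>\<theta>. (norm (\<theta> - \<theta>s))\<^sup>2 - 2 * \<gamma> * weight \<theta> * ((\<theta> - \<theta>s) \<bullet> G \<theta>)
        + \<gamma>\<^sup>2 * (\<integral>\<omega>. exp ((- \<theta>) \<bullet> X \<omega> - \<psi> (- \<theta>)) * (norm (update_field M X F lam \<theta> (X \<omega>)))\<^sup>2 \<partial>M)"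
  shows one_step: "(\<integral>\<^sup>+\<omega>. ennreal (exp ((- \<theta>) \<bullet> X \<omega> - \<psi> (- \<theta>))
        * (norm (\<theta> - \<gamma> *\<^sub>R update_field M X F lam \<theta> (X \<omega>) - \<theta>s))\<^sup>2) \<partial>M) = ennreal (L \<theta>)"
    and one_step_nonneg: "L \<theta> \<ge> 0"
proof -
  let ?w = "\<lambda>\<omega>. exp ((- \<theta>) \<bullet> X \<omega> - \<psi> (- \<theta>))"
  let ?H = "\<lambda>\<omega>. update_field M X F lam \<theta> (X \<omega>)"
  have eq: "?w \<omega> * (norm (\<theta> - \<gamma> *\<^sub>R ?H \<omega> - \<theta>s))\<^sup>2
      = ?w \<omega> * (norm (\<theta> - \<theta>s))\<^sup>2 - (2 * \<gamma>) * ((\<theta> - \<theta>s) \<bullet> (?w \<omega> *\<^sub>R ?H \<omega>)) + \<gamma>\<^sup>2 * (?w \<omega> * (norm (?H \<omega>))\<^sup>2)" for \<omega>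
  proof -
    have "\<theta> - \<gamma> *\<^sub>R ?H \<omega> - \<theta>s = (\<theta> - \<theta>s) - \<gamma> *\<^sub>R ?H \<omega>" by simp
    then have "(norm (\<theta> - \<gamma> *\<^sub>R ?H \<omega> - \<theta>s))\<^sup>2
        = (norm (\<theta> - \<theta>s))\<^sup>2 - 2 * \<gamma> * ((\<theta> - \<theta>s) \<bullet> ?H \<omega>) + \<gamma>\<^sup>2 * (norm (?H \<omega>))\<^sup>2"
      by (simp only: power2_norm_eq_inner)
        (simp add: inner_diff_left inner_diff_right inner_commute power2_eq_square)
    then show ?thesis by (simp only: inner_scaleR_right) (simp add: algebra_simps)
  qed
  have i1: "integrable M (\<lambda>\<omega>. ?w \<omega> * (norm (\<theta> - \<theta>s))\<^sup>2)"
    by (intro integrable_mult_left integrable_tilted_1)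
  have i2: "integrable M (\<lambda>\<omega>. (2 * \<gamma>) * ((\<theta> - \<theta>s) \<bullet> (?w \<omega> *\<^sub>R ?H \<omega>)))"
    by (intro integrable_mult_right integrable_inner_right integrable_update_field)
  have i3: "integrable M (\<lambda>\<omega>. \<gamma>\<^sup>2 * (?w \<omega> * (norm (?H \<omega>))\<^sup>2))"
    by (intro integrable_mult_right integrable_update_field_sq)
  have int: "integrable M (\<lambda>\<omega>. ?w \<omega> * (norm (\<theta> - \<gamma> *\<^sub>R ?H \<omega> - \<theta>s))\<^sup>2)"
    unfolding eq by (intro Bochner_Integration.integrable_add Bochner_Integration.integrable_diff i1 i2 i3)
  have "(\<integral>\<omega>. ?w \<omega> * (norm (\<theta> - \<gamma> *\<^sub>R ?H \<omega> - \<theta>s))\<^sup>2 \<partial>M)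
      = (\<integral>\<omega>. ?w \<omega> * (norm (\<theta> - \<theta>s))\<^sup>2 \<partial>M) - (\<integral>\<omega>. (2 * \<gamma>) * ((\<theta> - \<theta>s) \<bullet> (?w \<omega> *\<^sub>R ?H \<omega>)) \<partial>M)
        + (\<integral>\<omega>. \<gamma>\<^sup>2 * (?w \<omega> * (norm (?H \<omega>))\<^sup>2) \<partial>M)"
    unfolding eq
    by (simp only: Bochner_Integration.integral_add[OF Bochner_Integration.integrable_diff[OF i1 i2] i3]
        Bochner_Integration.integral_diff[OF i1 i2])
  also have "(\<integral>\<omega>. (2 * \<gamma>) * ((\<theta> - \<theta>s) \<bullet> (?w \<omega> *\<^sub>R ?H \<omega>)) \<partial>M) = 2 * \<gamma> * ((\<theta> - \<theta>s) \<bullet> (weight \<theta> *\<^sub>R G \<theta>))"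
    by (simp only: integral_mult_right_zero integral_inner_right[OF integrable_update_field] mean_update_field)
  also have "(\<integral>\<omega>. ?w \<omega> * (norm (\<theta> - \<theta>s))\<^sup>2 \<partial>M) = (norm (\<theta> - \<theta>s))\<^sup>2"
    by (simp only: integral_mult_left_zero integral_tilted_1 mult_1)
  also have "(\<integral>\<omega>. \<gamma>\<^sup>2 * (?w \<omega> * (norm (?H \<omega>))\<^sup>2) \<partial>M) = \<gamma>\<^sup>2 * (\<integral>\<omega>. ?w \<omega> * (norm (?H \<omega>))\<^sup>2 \<partial>M)"
    by (rule integral_mult_right_zero)
  finally have L: "(\<integral>\<omega>. ?w \<omega> * (norm (\<theta> - \<gamma> *\<^sub>R ?H \<omega> - \<theta>s))\<^sup>2 \<partial>M) = L \<theta>"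
    unfolding L_def by (simp only: inner_scaleR_right mult.assoc)
  show "(\<integral>\<^sup>+\<omega>. ennreal (?w \<omega> * (norm (\<theta> - \<gamma> *\<^sub>R ?H \<omega> - \<theta>s))\<^sup>2) \<partial>M) = ennreal (L \<theta>)"
    unfolding L[symmetric] by (intro nn_integral_eq_integral int) auto
  show "L \<theta> \<ge> 0"
    unfolding L[symmetric] by (intro Bochner_Integration.integral_nonneg) auto
qed

text \<open>A lower bound for \<open>weight \<theta> * ((\<theta> - \<theta>s) \<bullet> G
  \<theta>)\<close> whose continuity and positivity away from the minimizer are inherited directly
  from \<open>V\<close>.\<close>

definition drift :: "real ^ 'n \<Rightarrow> real ^ 'n \<Rightarrow> real"
  where "drift \<theta>s \<theta> = weight \<theta> * (V \<theta> - V \<theta>s)"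

lemma continuous_drift: "continuous_on A (drift \<theta>s)"
  unfolding drift_def by (intro continuous_intros continuous_weight continuous_V)

text \<open>Recentres the second moment bound at \<open>\<theta>s\<close>, using \<open>(norm
  \<theta>)^2 \<le> 2 * (norm (\<theta> - \<theta>s))^2 + 2 * (norm \<theta>s)^2\<close>.\<close>

definition growth_const :: "real ^ 'n \<Rightarrow> real"
  where "growth_const \<theta>s = second_moment_const * (1 + 2 * (16 * \<delta>)\<^sup>2 * (1 + (norm \<theta>s)\<^sup>2))"

lemma growth_const_nonneg: "growth_const \<theta>s \<ge> 0"
  unfolding growth_const_def using second_moment_const_nonneg by (intro mult_nonneg_nonneg) auto

text \<open>The descent inequality for a fixed vector \<open>\<theta>\<close>; it passes to the
  random iterate by freezing the past. \<open>V_tangent\<close> handles the cross term and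
  \<open>update_field_sq_le\<close> the quadratic one.\<close>

lemma one_step_le:
  assumes "\<gamma> > 0" and min: "V \<theta>s \<le> V \<theta>"
  shows "(\<integral>\<^sup>+\<omega>. ennreal (exp ((- \<theta>) \<bullet> X \<omega> - \<psi> (- \<theta>)) * (norm (\<theta> - \<gamma> *\<^sub>R update_field M X F lam \<theta> (X \<omega>) - \<theta>s))\<^sup>2) \<partial>M)
      + ennreal (2 * \<gamma> * drift \<theta>s \<theta>)
      \<le> ennreal ((1 + growth_const \<theta>s * \<gamma>\<^sup>2) * (norm (\<theta> - \<theta>s))\<^sup>2 + growth_const \<theta>s * \<gamma>\<^sup>2)"
proof -
  let ?S = "(\<integral>\<omega>. exp ((- \<theta>) \<bullet> X \<omega> - \<psi> (- \<theta>)) * (norm (update_field M X F lam \<theta> (X \<omega>)))\<^sup>2 \<partial>M)"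
  let ?L = "(norm (\<theta> - \<theta>s))\<^sup>2 - 2 * \<gamma> * weight \<theta> * ((\<theta> - \<theta>s) \<bullet> G \<theta>) + \<gamma>\<^sup>2 * ?S"
  have drift0: "drift \<theta>s \<theta> \<ge> 0" using min weight_pos[of \<theta>] by (simp add: drift_def)
  have "V \<theta> - V \<theta>s \<le> (\<theta> - \<theta>s) \<bullet> G \<theta>" using V_tangent[of \<theta> \<theta>s] by (simp add: inner_diff_left)
  then have "drift \<theta>s \<theta> \<le> weight \<theta> * ((\<theta> - \<theta>s) \<bullet> G \<theta>)"
    unfolding drift_def using weight_pos[of \<theta>] by (intro mult_left_mono) auto
  then have d: "2 * \<gamma> * drift \<theta>s \<theta> \<le> 2 * \<gamma> * weight \<theta> * ((\<theta> - \<theta>s) \<bullet> G \<theta>)"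
    using assms(1) by (simp add: mult.assoc)
  have "?S \<le> second_moment_const * (1 + (16 * \<delta> * norm \<theta>)\<^sup>2)" by (rule update_field_sq_le)
  also have "\<dots> \<le> growth_const \<theta>s * (1 + (norm (\<theta> - \<theta>s))\<^sup>2)"
  proof -
    have "(norm \<theta>)\<^sup>2 \<le> (norm (\<theta> - \<theta>s) + norm \<theta>s)\<^sup>2"
      using norm_triangle_ineq[of "\<theta> - \<theta>s" \<theta>s] by (intro power_mono) auto
    also have "\<dots> \<le> 2 * (norm (\<theta> - \<theta>s))\<^sup>2 + 2 * (norm \<theta>s)\<^sup>2" by (rule square_add_le)
    also have "\<dots> \<le> 2 * (1 + (norm \<theta>s)\<^sup>2) * (1 + (norm (\<theta> - \<theta>s))\<^sup>2)" by (simp add: algebra_simps)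
    finally have "(16 * \<delta>)\<^sup>2 * (norm \<theta>)\<^sup>2 \<le> (16 * \<delta>)\<^sup>2 * (2 * (1 + (norm \<theta>s)\<^sup>2) * (1 + (norm (\<theta> - \<theta>s))\<^sup>2))"
      by (intro mult_left_mono) auto
    then have "1 + (16 * \<delta> * norm \<theta>)\<^sup>2
        \<le> (1 + 2 * (16 * \<delta>)\<^sup>2 * (1 + (norm \<theta>s)\<^sup>2)) * (1 + (norm (\<theta> - \<theta>s))\<^sup>2)"
      by (simp add: power_mult_distrib algebra_simps add_increasing)
    then show ?thesis
      unfolding growth_const_def mult.assoc[of second_moment_const]
      by (intro mult_left_mono second_moment_const_nonneg)
  qed
  finally have "\<gamma>\<^sup>2 * ?S \<le> \<gamma>\<^sup>2 * (growth_const \<theta>s * (1 + (norm (\<theta> - \<theta>s))\<^sup>2))"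
    by (intro mult_left_mono) auto
  with d have "?L + 2 * \<gamma> * drift \<theta>s \<theta>
      \<le> (norm (\<theta> - \<theta>s))\<^sup>2 + \<gamma>\<^sup>2 * (growth_const \<theta>s * (1 + (norm (\<theta> - \<theta>s))\<^sup>2))" by linarith
  also have "\<dots> = (1 + growth_const \<theta>s * \<gamma>\<^sup>2) * (norm (\<theta> - \<theta>s))\<^sup>2 + growth_const \<theta>s * \<gamma>\<^sup>2"
    by (simp add: algebra_simps)
  finally have le: "?L + 2 * \<gamma> * drift \<theta>s \<theta>
      \<le> (1 + growth_const \<theta>s * \<gamma>\<^sup>2) * (norm (\<theta> - \<theta>s))\<^sup>2 + growth_const \<theta>s * \<gamma>\<^sup>2" .
  show ?thesis
    unfolding one_step
    using le drift0 assms(1) one_step_nonneg[of \<theta> \<theta>s \<gamma>]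
    by (subst ennreal_plus[symmetric]) (auto intro: ennreal_leI simp del: ennreal_plus)
qed

end

section \<open>Independence of the past\<close>

text \<open>
  The second factor need not be second countable: an open set of the product is a countable union
  of open rectangles whose first sides come from a countable basis of the first factor.
\<close>

lemma measurable_restrict_borel_Times:
  fixes f :: "'c::second_countable_topology \<times> 'b::topological_space \<Rightarrow> 'v::topological_space"
  assumes "f \<in> borel_measurable (restrict_space borel (UNIV \<times> S))"
  shows "f \<in> borel_measurable (borel \<Otimes>\<^sub>M restrict_space borel S)"
proof -
  let ?N = "(borel :: 'c measure) \<Otimes>\<^sub>M restrict_space (borel :: 'b measure) S"
  have sp: "space ?N = UNIV \<times> S"
    by (simp add: space_pair_measure space_restrict_space)
  have "(\<lambda>z. z) \<in> borel_measurable ?N"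
  proof (rule borel_measurableI)
    fix O' :: "('c \<times> 'b) set" assume O': "open O'"
    obtain B :: "'c set set" where B: "countable B" "topological_basis B"
      using ex_countable_basis by blast
    \<comment> \<open>The largest open second side that fits over \<open>U\<close>. The union may be
      uncountable, but it is open, so only the first sides need a countable family.\<close>
    define W where "W U = \<Union>{T. open T \<and> U \<times> T \<subseteq> O'}" for U
    have "O' = (\<Union>U\<in>B. U \<times> W U)"
    proof (intro equalityI subsetI)
      fix z assume "z \<in> O'"
      obtain x y where z: "z = (x, y)" by (cases z)
      from open_prod_elim[OF O' \<open>z \<in> O'\<close>] obtain P Q
        where PQ: "open P" "open Q" "z \<in> P \<times> Q" "P \<times> Q \<subseteq> O'" by metis
      then obtain U where U: "U \<in> B" "x \<in> U" "U \<subseteq> P"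
        using topological_basisE[OF B(2), of P x] z by auto
      then have "y \<in> W U" using PQ z by (auto simp: W_def)
      then show "z \<in> (\<Union>U\<in>B. U \<times> W U)" using U z by blast
    qed (auto simp: W_def)
    then have "(\<lambda>z. z) -` O' \<inter> space ?N = (\<Union>U\<in>B. U \<times> (S \<inter> W U))"
      unfolding sp by auto
    also have "\<dots> \<in> sets ?N"
    proof -
      have "U \<times> (S \<inter> W U) \<in> sets ?N" if "U \<in> B" for U
      proof (rule pair_measureI)
        show "U \<in> sets borel" using topological_basis_open[OF B(2) that] by auto
        have "W U \<in> sets borel" unfolding W_def by (intro borel_open open_Union) auto
        then show "S \<inter> W U \<in> sets (restrict_space borel S)" by (auto simp: sets_restrict_space)
      qed
      then show ?thesis by (intro sets.countable_UN' B(1)) auto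
    qed
    finally show "(\<lambda>z. z) -` O' \<inter> space ?N \<in> sets ?N" .
  qed
  then have "(\<lambda>z. z) \<in> measurable ?N (restrict_space borel (UNIV \<times> S))"
    using sp by (intro measurable_restrict_space2) auto
  from measurable_compose[OF this assms] show ?thesis by simp
qed

text \<open>Generated by the tuple map, so that each event of the past is a preimage from the
  product space, which is the form in which independence of blocks of indices is available. For
  \<open>n = 0\<close> the algebra is trivial.\<close>

definition history_algebra :: "'a measure \<Rightarrow> 'b measure \<Rightarrow> (nat \<Rightarrow> 'a \<Rightarrow> 'b) \<Rightarrow> nat \<Rightarrow> 'a measure"
  where "history_algebra M R \<xi>s n =
    vimage_algebra (space M) (\<lambda>\<omega>. \<lambda>i\<in>{1..n}. \<xi>s i \<omega>) (PiM {1..n} (\<lambda>_. R))"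

context prob_space
begin

context
  fixes R :: "'b measure" and \<xi>s :: "nat \<Rightarrow> 'a \<Rightarrow> 'b"
  assumes indep: "indep_vars (\<lambda>_. R) \<xi>s {1..}"
begin

abbreviation "tup \<equiv> \<lambda>n \<omega>. \<lambda>i\<in>{1..n}. \<xi>s i \<omega>"
abbreviation "hist \<equiv> history_algebra M R \<xi>s"

lemma \<xi>s_measurable: "i \<ge> 1 \<Longrightarrow> \<xi>s i \<in> measurable M R"
  using indep by (auto simp: indep_vars_def)

lemma tup_measurable: "tup n \<in> measurable M (PiM {1..n} (\<lambda>_. R))"
  by (intro measurable_restrict \<xi>s_measurable) auto

lemma space_history: "space (hist n) = space M"
  by (simp add: history_algebra_def)

lemma sets_history: "sets (hist n) = {tup n -` A \<inter> space M | A. A \<in> sets (PiM {1..n} (\<lambda>_. R))}"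
  unfolding history_algebra_def
  using measurable_space[OF tup_measurable] by (intro sets_vimage_algebra2) auto

lemma subalgebra_history: "subalgebra M (hist n)"
  using measurable_sets[OF tup_measurable] by (auto simp: subalgebra_def space_history sets_history)

lemma \<xi>s_measurable_history:
  assumes "1 \<le> i" "i \<le> n"
  shows "\<xi>s i \<in> measurable (hist n) R"
proof -
  have "tup n \<in> measurable (hist n) (PiM {1..n} (\<lambda>_. R))"
    unfolding history_algebra_def
    using measurable_space[OF tup_measurable] by (intro measurable_vimage_algebra1) auto
  moreover have "(\<lambda>t. t i) \<in> measurable (PiM {1..n} (\<lambda>_. R)) R"
    using assms by (intro measurable_component_singleton) auto
  ultimately have "(\<lambda>\<omega>. tup n \<omega> i) \<in> measurable (hist n) R"
    by (rule measurable_compose)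
  then show ?thesis using assms by simp
qed

lemma history_mono: "sets (hist n) \<subseteq> sets (hist (Suc n))"
proof
  fix B assume "B \<in> sets (hist n)"
  then obtain A where A: "A \<in> sets (PiM {1..n} (\<lambda>_. R))" "B = tup n -` A \<inter> space M"
    by (auto simp: sets_history)
  have "tup n \<in> measurable (hist (Suc n)) (PiM {1..n} (\<lambda>_. R))"
    by (intro measurable_restrict \<xi>s_measurable_history) auto
  from measurable_sets[OF this A(1)] show "B \<in> sets (hist (Suc n))"
    by (simp add: A(2) space_history)
qed

lemma id_measurable_history: "(\<lambda>\<omega>. \<omega>) \<in> measurable M (hist n)"
  using measurable_from_subalg[OF subalgebra_history[of n] measurable_ident_sets[OF refl]] by simp

text \<open>The identity map into \<open>hist n\<close> carries the whole past as one random
  variable, so its independence of the next innovation can be expressed as a product law.\<close>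

lemma distr_history_pair:
  "distr M (hist n) (\<lambda>\<omega>. \<omega>) \<Otimes>\<^sub>M distr M R (\<xi>s (Suc n))
    = distr M (hist n \<Otimes>\<^sub>M R) (\<lambda>\<omega>. (\<omega>, \<xi>s (Suc n) \<omega>))"
proof -
  note [measurable] = id_measurable_history[of n] \<xi>s_measurable[of "Suc n", simplified]
  interpret D1: prob_space "distr M (hist n) (\<lambda>\<omega>. \<omega>)" by (rule prob_space_distr) measurable
  interpret D2: prob_space "distr M R (\<xi>s (Suc n))" by (rule prob_space_distr) measurable
  \<comment> \<open>Independence of blocks compares tuples with tuples, so the single innovation is
    wrapped into a one-element tuple; \<open>?A\<close> unwraps it.\<close>
  let ?t = "\<lambda>\<omega>. \<lambda>i\<in>{Suc n}. \<xi>s i \<omega>"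
  have indep': "indep_var (PiM {1..n} (\<lambda>_. R)) (tup n) (PiM {Suc n} (\<lambda>_. R)) ?t"
    using indep by (rule indep_var_restrict) auto
  show ?thesis
  proof (rule pair_measure_eqI)
    fix B A assume "B \<in> sets (distr M (hist n) (\<lambda>\<omega>. \<omega>))" and "A \<in> sets (distr M R (\<xi>s (Suc n)))"
    then have BF[measurable]: "B \<in> sets (hist n)" and A[measurable]: "A \<in> sets R" by auto
    then obtain B' where B': "B' \<in> sets (PiM {1..n} (\<lambda>_. R))" "B = tup n -` B' \<inter> space M"
      by (auto simp: sets_history)
    let ?A = "(\<lambda>t. t (Suc n)) -` A \<inter> space (PiM {Suc n} (\<lambda>_. R))"
    have A': "?A \<in> sets (PiM {Suc n} (\<lambda>_. R))"
      by (rule measurable_sets[OF _ A]) (auto intro: measurable_component_singleton)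
    have "?t \<in> measurable M (PiM {Suc n} (\<lambda>_. R))"
      by (intro measurable_restrict \<xi>s_measurable) auto
    from measurable_space[OF this]
    have tA: "?t -` ?A \<inter> space M = \<xi>s (Suc n) -` A \<inter> space M" by auto
    have "prob ((\<lambda>\<omega>. (tup n \<omega>, ?t \<omega>)) -` (B' \<times> ?A) \<inter> space M)
        = prob (tup n -` B' \<inter> space M) * prob (?t -` ?A \<inter> space M)"
      using indep' B'(1) A' by (rule indep_varD)
    moreover have "(\<lambda>\<omega>. (tup n \<omega>, ?t \<omega>)) -` (B' \<times> ?A) \<inter> space M
        = (tup n -` B' \<inter> space M) \<inter> (?t -` ?A \<inter> space M)" by auto
    ultimately have "prob (B \<inter> (\<xi>s (Suc n) -` A \<inter> space M)) = prob B * prob (\<xi>s (Suc n) -` A \<inter> space M)"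
      unfolding tA B'(2) by simp
    moreover have "B \<subseteq> space M" using B'(2) by auto
    then have "(\<lambda>\<omega>. (\<omega>, \<xi>s (Suc n) \<omega>)) -` (B \<times> A) \<inter> space M = B \<inter> (\<xi>s (Suc n) -` A \<inter> space M)"
      "(\<lambda>\<omega>. \<omega>) -` B \<inter> space M = B" by auto
    ultimately show "emeasure (distr M (hist n) (\<lambda>\<omega>. \<omega>)) B * emeasure (distr M R (\<xi>s (Suc n))) A
        = emeasure (distr M (hist n \<Otimes>\<^sub>M R) (\<lambda>\<omega>. (\<omega>, \<xi>s (Suc n) \<omega>))) (B \<times> A)"
      by (simp add: emeasure_distr emeasure_eq_measure ennreal_mult'')
  qed (auto intro: D1.sigma_finite_measure_axioms D2.sigma_finite_measure_axioms
      cong: sets_pair_measure_cong)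
qed

text \<open>Fubini for this product law: the past is frozen while the next innovation is integrated
  out. This takes the place of conditioning on \<open>hist n\<close>.\<close>

lemma nn_integral_history:
  assumes f: "case_prod f \<in> borel_measurable (hist n \<Otimes>\<^sub>M R)"
  shows "(\<integral>\<^sup>+\<omega>. f \<omega> (\<xi>s (Suc n) \<omega>) \<partial>M) = (\<integral>\<^sup>+\<omega>. (\<integral>\<^sup>+y. f \<omega> y \<partial>distr M R (\<xi>s (Suc n))) \<partial>M)"
proof -
  have rv: "(\<lambda>\<omega>. \<omega>) \<in> measurable M (hist n)" "\<xi>s (Suc n) \<in> measurable M R"
    using id_measurable_history \<xi>s_measurable by auto
  interpret D: prob_space "distr M R (\<xi>s (Suc n))" by (rule prob_space_distr[OF rv(2)])
  have "(\<integral>\<^sup>+\<omega>. f \<omega> (\<xi>s (Suc n) \<omega>) \<partial>M)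
      = (\<integral>\<^sup>+z. case_prod f z \<partial>distr M (hist n \<Otimes>\<^sub>M R) (\<lambda>\<omega>. (\<omega>, \<xi>s (Suc n) \<omega>)))"
    using rv f by (subst nn_integral_distr) auto
  also have "\<dots> = (\<integral>\<^sup>+z. case_prod f z \<partial>(distr M (hist n) (\<lambda>\<omega>. \<omega>) \<Otimes>\<^sub>M distr M R (\<xi>s (Suc n))))"
    by (simp only: distr_history_pair)
  also have "\<dots> = (\<integral>\<^sup>+\<omega>. (\<integral>\<^sup>+y. f \<omega> y \<partial>distr M R (\<xi>s (Suc n))) \<partial>distr M (hist n) (\<lambda>\<omega>. \<omega>))"
    using f by (subst D.nn_integral_fst[symmetric]) (auto cong: measurable_cong_sets sets_pair_measure_cong)
  also have "\<dots> = (\<integral>\<^sup>+\<omega>. (\<integral>\<^sup>+y. f \<omega> y \<partial>distr M R (\<xi>s (Suc n))) \<partial>M)"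
  proof (rule nn_integral_distr[OF rv(1)])
    have "case_prod f \<in> borel_measurable (hist n \<Otimes>\<^sub>M distr M R (\<xi>s (Suc n)))"
      using f by (simp cong: measurable_cong_sets sets_pair_measure_cong)
    then show "(\<lambda>\<omega>. \<integral>\<^sup>+y. f \<omega> y \<partial>distr M R (\<xi>s (Suc n))) \<in> borel_measurable (distr M (hist n) (\<lambda>\<omega>. \<omega>))"
      by (simp add: D.borel_measurable_nn_integral)
  qed
  finally show ?thesis .
qed

end

end

text \<open>Only the law of \<open>Y\<close> matters, so a simulated point can be traded for
  \<open>X\<close> weighted by the likelihood ratio
  \<open>exp (u \<bullet> X \<omega> - \<psi> u)\<close>.\<close>

lemma (in importance_sampling) nn_integral_esscher:
  assumes Y: "distributed M lborel Y (\<lambda>x. ennreal (esscher_density M X p u x))"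
    and [measurable]: "h \<in> borel_measurable borel"
  shows "(\<integral>\<^sup>+\<omega>. h (Y \<omega>) \<partial>M) = (\<integral>\<^sup>+\<omega>. ennreal (exp (u \<bullet> X \<omega> - \<psi> u)) * h (X \<omega>) \<partial>M)"
proof -
  have "(\<integral>\<^sup>+\<omega>. h (Y \<omega>) \<partial>M) = (\<integral>\<^sup>+x. ennreal (esscher_density M X p u x) * h x \<partial>lborel)"
    by (rule distributed_nn_integral[OF Y, symmetric]) simp
  also have "\<dots> = (\<integral>\<^sup>+x. ennreal (p x) * (ennreal (exp (u \<bullet> x - \<psi> u)) * h x) \<partial>lborel)"
    using p_pos by (intro nn_integral_cong) (simp add: esscher_density_def ennreal_mult' less_imp_le ac_simps)
  also have "\<dots> = (\<integral>\<^sup>+\<omega>. ennreal (exp (u \<bullet> X \<omega> - \<psi> u)) * h (X \<omega>) \<partial>M)"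
    by (rule distributed_nn_integral[OF X_density]) simp
  finally show ?thesis .
qed

section \<open>Almost sure convergence\<close>

theorem theorem3:
  fixes M :: "'a measure"
    and X :: "'a \<Rightarrow> real ^ 'n"
    and p F :: "real ^ 'n \<Rightarrow> real"
    and S :: "'b::metric_space set"
    and g :: "real ^ 'n \<Rightarrow> 'b \<Rightarrow> real ^ 'n"
    and \<xi> :: "'a \<Rightarrow> 'b"
    and \<xi>s :: "nat \<Rightarrow> 'a \<Rightarrow> 'b"
    and \<gamma> :: "nat \<Rightarrow> real"
    and C lam :: real
    and \<theta>0 :: "real ^ 'n"
    and \<theta> Y :: "nat \<Rightarrow> 'a \<Rightarrow> real ^ 'n"
  assumes "prob_space M"
    and "distributed M lborel X (\<lambda>x. ennreal (p x))"
    and "\<And>x. p x > 0"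
    and "F \<in> borel_measurable borel"
    and "integrable M (\<lambda>\<omega>. (F (X \<omega>))\<^sup>2)"
    and "measure M {\<omega> \<in> space M. F (X \<omega>) \<noteq> 0} > 0"
    and "\<And>u. integrable M (\<lambda>\<omega>. exp (u \<bullet> X \<omega>))"
    and "S \<in> sets borel"
    and "\<xi> \<in> measurable M (restrict_space borel S)"
    and "(\<lambda>(u, y). g u y) \<in> borel_measurable (restrict_space borel (UNIV \<times> S))"
    and "\<And>u. distributed M lborel (\<lambda>\<omega>. g u (\<xi> \<omega>)) (\<lambda>x. ennreal (esscher_density M X p u x))"
    and "filterlim (\<lambda>u. cgf M X u - 2 * cgf M X (u /\<^sub>R 2)) at_top at_infinity"
    and "\<exists>\<delta>>0. concave_on UNIV (\<lambda>u. cgf M X u - \<delta> * (norm u)\<^sup>2)"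
    and "\<And>u. integrable M (\<lambda>\<omega>. norm (X \<omega>) * (F (X \<omega>))\<^sup>2 * exp (u \<bullet> X \<omega>))"
    and "C > 0" and "lam \<ge> 0"
    and "\<And>x. \<bar>F x\<bar> \<le> C * exp (lam / 4 * norm x)"
    and "integrable M (\<lambda>\<omega>. (norm (X \<omega>))\<^sup>2 * exp (lam * norm (X \<omega>)))"
    and "\<And>n. n \<ge> 1 \<Longrightarrow> \<gamma> n > 0"
    and "filterlim (\<lambda>N. \<Sum>n=1..N. \<gamma> n) at_top sequentially"
    and "summable (\<lambda>n. (\<gamma> (Suc n))\<^sup>2)"
    and "prob_space.indep_vars M (\<lambda>_. restrict_space borel S) \<xi>s {1..}"
    and "\<And>n. n \<ge> 1 \<Longrightarrow>
           distr M (restrict_space borel S) (\<xi>s n) = distr M (restrict_space borel S) \<xi>"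
    and "\<And>\<omega>. \<omega> \<in> space M \<Longrightarrow> \<theta> 0 \<omega> = \<theta>0"
    and "\<And>n \<omega>. \<omega> \<in> space M \<Longrightarrow> Y (Suc n) \<omega> = g (- \<theta> n \<omega>) (\<xi>s (Suc n) \<omega>)"
    and "\<And>n \<omega>. \<omega> \<in> space M \<Longrightarrow>
           \<theta> (Suc n) \<omega> = \<theta> n \<omega> - \<gamma> (Suc n) *\<^sub>R update_field M X F lam (\<theta> n \<omega>) (Y (Suc n) \<omega>)"
  shows "\<exists>\<theta>star. \<theta>star \<in> borel_measurable M
           \<and> (\<forall>\<omega>\<in>space M. \<theta>star \<omega> \<in> Argmin (importance_variance M X p F))
           \<and> integrable M (\<lambda>\<omega>. (norm (\<theta>star \<omega>))\<^sup>2)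
           \<and> (AE \<omega> in M. (\<lambda>n. \<theta> n \<omega>) \<longlonglongrightarrow> \<theta>star \<omega>)"
proof -
  obtain \<delta> where \<delta>: "\<delta> > 0" "concave_on UNIV (\<lambda>u. cgf M X u - \<delta> * (norm u)\<^sup>2)"
    using assms(13) by blast
  interpret prob_space M by fact
  interpret importance_sampling M X \<delta> p F C lam
  proof
    show "X \<in> borel_measurable M" using distributed_measurable[OF assms(2)] by simp
  qed (fact assms \<delta>)+
  obtain \<theta>s where \<theta>s: "\<And>v. v \<noteq> \<theta>s \<Longrightarrow> V \<theta>s < V v" using V_minimizer by blast
  then have min: "V \<theta>s \<le> V v" for v by (cases "v = \<theta>s") (auto simp: less_imp_le)
  define R where "R = restrict_space (borel :: 'b measure) S"
  have ind: "indep_vars (\<lambda>_. R) \<xi>s {1..}" using assms(22) by (simp add: R_def)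
  define hist where "hist = history_algebra M R \<xi>s"
  have sub: "subalgebra M (hist n)" for n unfolding hist_def by (rule subalgebra_history[OF ind])
  have mono: "sets (hist n) \<subseteq> sets (hist (Suc n))" for n unfolding hist_def by (rule history_mono[OF ind])
  have space_hist: "space (hist n) = space M" for n using sub[of n] by (simp add: subalgebra_def)
  \<comment> \<open>Borel measurability for the product topology is turned into measurability for
    the product algebra, as composition and Fubini require.\<close>
  have g[measurable]: "(\<lambda>(u, y). g u y) \<in> borel_measurable (borel \<Otimes>\<^sub>M R)"
    unfolding R_def by (rule measurable_restrict_borel_Times[OF assms(10)])
  define \<Phi> where "\<Phi> n v y = v - \<gamma> (Suc n) *\<^sub>R update_field M X F lam v (g (- v) y)" for n v y
  have \<Phi>_meas: "(\<lambda>(v, y). \<Phi> n v y) \<in> borel_measurable (borel \<Otimes>\<^sub>M R)" for n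
    unfolding \<Phi>_def by measurable
  have step: "\<theta> (Suc n) \<omega> = \<Phi> n (\<theta> n \<omega>) (\<xi>s (Suc n) \<omega>)" if "\<omega> \<in> space M" for n \<omega>
    using assms(25,26)[OF that] by (simp add: \<Phi>_def)
  have \<theta>_meas: "\<theta> n \<in> borel_measurable (hist n)" for n
  proof (induction n)
    case 0
    have "(\<lambda>_. \<theta>0) \<in> borel_measurable (hist 0)" by simp
    then show ?case using assms(24) by (subst measurable_cong[where g = "\<lambda>_. \<theta>0"]) (auto simp: space_hist)
  next
    case (Suc n)
    have "subalgebra (hist (Suc n)) (hist n)" using mono space_hist by (auto simp: subalgebra_def)
    then have [measurable]: "\<theta> n \<in> borel_measurable (hist (Suc n))"
      using Suc by (rule measurable_from_subalg)
    have [measurable]: "\<xi>s (Suc n) \<in> measurable (hist (Suc n)) R"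
      unfolding hist_def by (rule \<xi>s_measurable_history[OF ind]) auto
    note [measurable] = \<Phi>_meas[of n]
    have "(\<lambda>\<omega>. \<Phi> n (\<theta> n \<omega>) (\<xi>s (Suc n) \<omega>)) \<in> borel_measurable (hist (Suc n))" by measurable
    then show ?case using step by (subst measurable_cong) (auto simp: space_hist)
  qed
  let ?K = "growth_const \<theta>s"
  have "AE \<omega> in M. (\<lambda>n. \<theta> n \<omega>) \<longlonglongrightarrow> \<theta>s"
  \<comment> \<open>The step from time \<open>n\<close> to \<open>Suc n\<close> has size
    \<open>\<gamma> (Suc n)\<close>, hence the shifted index.\<close>
  proof (rule stochastic_descent_tendsto[where F = hist and b = "drift \<theta>s" and g = "\<lambda>n. \<gamma> (Suc n)" and K = ?K])
    show "\<not> summable (\<lambda>n. \<gamma> (Suc n))"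
    proof
      assume "summable (\<lambda>n. \<gamma> (Suc n))"
      then have "(\<lambda>N. \<Sum>n<N. \<gamma> (Suc n)) \<longlonglongrightarrow> (\<Sum>n. \<gamma> (Suc n))" by (rule summable_LIMSEQ)
      moreover have "filterlim (\<lambda>N. \<Sum>n<N. \<gamma> (Suc n)) at_infinity sequentially"
        using filterlim_at_top_imp_at_infinity[OF assms(20)] by (simp add: sum.atLeast1_atMost_eq)
      ultimately show False using not_tendsto_and_filterlim_at_infinity sequentially_bot by blast
    qed
    show "drift \<theta>s v \<ge> 0" for v using min[of v] weight_pos[of v] by (simp add: drift_def)
    show "drift \<theta>s v > 0" if "v \<noteq> \<theta>s" for v using \<theta>s[OF that] weight_pos[of v] by (simp add: drift_def)
    fix n B assume B: "B \<in> sets (hist n)"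
    \<comment> \<open>The indicator of the past event \<open>B\<close> is part of the integrand, so
      that \<open>nn_integral_history\<close> covers integrals over \<open>B\<close>.\<close>
    define h where "h \<omega> y = ennreal ((norm (\<Phi> n (\<theta> n \<omega>) y - \<theta>s))\<^sup>2) * indicator B \<omega>" for \<omega> y
    have h_meas: "case_prod h \<in> borel_measurable (hist n \<Otimes>\<^sub>M R)"
    proof -
      note [measurable] = \<theta>_meas[of n] \<Phi>_meas[of n] B
      show ?thesis unfolding h_def by measurable
    qed
    have inner: "(\<integral>\<^sup>+y. ennreal ((norm (\<Phi> n v y - \<theta>s))\<^sup>2) \<partial>distr M R (\<xi>s (Suc n)))
        + ennreal (2 * \<gamma> (Suc n) * drift \<theta>s v)
        \<le> ennreal ((1 + ?K * (\<gamma> (Suc n))\<^sup>2) * (norm (v - \<theta>s))\<^sup>2 + ?K * (\<gamma> (Suc n))\<^sup>2)" for v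
    proof -
      note [measurable] = \<Phi>_meas[of n]
      let ?f = "\<lambda>x. ennreal ((norm (v - \<gamma> (Suc n) *\<^sub>R update_field M X F lam v x - \<theta>s))\<^sup>2)"
      have "distr M R (\<xi>s (Suc n)) = distr M R \<xi>" using assms(23)[of "Suc n"] by (simp add: R_def)
      then have "(\<integral>\<^sup>+y. ennreal ((norm (\<Phi> n v y - \<theta>s))\<^sup>2) \<partial>distr M R (\<xi>s (Suc n)))
          = (\<integral>\<^sup>+\<omega>. ennreal ((norm (\<Phi> n v (\<xi> \<omega>) - \<theta>s))\<^sup>2) \<partial>M)"
        using assms(9) by (simp add: nn_integral_distr R_def[symmetric])
      also have "\<dots> = (\<integral>\<^sup>+\<omega>. ?f (g (- v) (\<xi> \<omega>)) \<partial>M)" by (simp add: \<Phi>_def)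
      also have "\<dots> = (\<integral>\<^sup>+\<omega>. ennreal (exp ((- v) \<bullet> X \<omega> - \<psi> (- v))) * ?f (X \<omega>) \<partial>M)"
        by (rule nn_integral_esscher[OF assms(11)]) measurable
      also have "\<dots> = (\<integral>\<^sup>+\<omega>. ennreal (exp ((- v) \<bullet> X \<omega> - \<psi> (- v))
          * (norm (v - \<gamma> (Suc n) *\<^sub>R update_field M X F lam v (X \<omega>) - \<theta>s))\<^sup>2) \<partial>M)"
        by (simp add: ennreal_mult')
      finally show ?thesis using one_step_le[of "\<gamma> (Suc n)" \<theta>s v] min assms(19) by simp
    qed
    have BM: "B \<in> sets M" using B sub[of n] by (auto simp: subalgebra_def)
    have \<theta>M: "\<theta> n \<in> borel_measurable M" using sub \<theta>_meas by (rule measurable_from_subalg)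
    have drift_meas: "drift \<theta>s \<in> borel_measurable borel"
      using continuous_drift by (rule borel_measurable_continuous_onI)
    have "(\<integral>\<^sup>+\<omega>\<in>B. ennreal ((norm (\<theta> (Suc n) \<omega> - \<theta>s))\<^sup>2) \<partial>M) = (\<integral>\<^sup>+\<omega>. h \<omega> (\<xi>s (Suc n) \<omega>) \<partial>M)"
      by (intro nn_integral_cong) (simp add: h_def step)
    also have "\<dots> = (\<integral>\<^sup>+\<omega>. (\<integral>\<^sup>+y. h \<omega> y \<partial>distr M R (\<xi>s (Suc n))) \<partial>M)"
      using h_meas unfolding hist_def by (rule nn_integral_history[OF ind])
    also have "\<dots> + (\<integral>\<^sup>+\<omega>\<in>B. ennreal (2 * \<gamma> (Suc n) * drift \<theta>s (\<theta> n \<omega>)) \<partial>M)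
        = (\<integral>\<^sup>+\<omega>. (\<integral>\<^sup>+y. h \<omega> y \<partial>distr M R (\<xi>s (Suc n)))
            + ennreal (2 * \<gamma> (Suc n) * drift \<theta>s (\<theta> n \<omega>)) * indicator B \<omega> \<partial>M)"
    proof (rule nn_integral_add[symmetric])
      have \<xi>M: "\<xi>s (Suc n) \<in> measurable M R" by (rule \<xi>s_measurable[OF ind]) simp
      interpret D: prob_space "distr M R (\<xi>s (Suc n))" by (rule prob_space_distr[OF \<xi>M])
      have "case_prod h \<in> borel_measurable (hist n \<Otimes>\<^sub>M distr M R (\<xi>s (Suc n)))"
        using h_meas by (simp cong: measurable_cong_sets sets_pair_measure_cong)
      then show "(\<lambda>\<omega>. \<integral>\<^sup>+y. h \<omega> y \<partial>distr M R (\<xi>s (Suc n))) \<in> borel_measurable M"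
        by (intro measurable_from_subalg[OF sub] D.borel_measurable_nn_integral)
      note [measurable] = BM \<theta>M drift_meas
      show "(\<lambda>\<omega>. ennreal (2 * \<gamma> (Suc n) * drift \<theta>s (\<theta> n \<omega>)) * indicator B \<omega>) \<in> borel_measurable M"
        by measurable
    qed
    also have "\<dots> \<le> (\<integral>\<^sup>+\<omega>\<in>B. ennreal ((1 + ?K * (\<gamma> (Suc n))\<^sup>2) * (norm (\<theta> n \<omega> - \<theta>s))\<^sup>2
        + ?K * (\<gamma> (Suc n))\<^sup>2) \<partial>M)"
      by (intro nn_integral_mono) (use inner in \<open>auto simp: h_def split: split_indicator\<close>)
    finally show "(\<integral>\<^sup>+\<omega>\<in>B. ennreal ((norm (\<theta> (Suc n) \<omega> - \<theta>s))\<^sup>2) \<partial>M)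
        + (\<integral>\<^sup>+\<omega>\<in>B. ennreal (2 * \<gamma> (Suc n) * drift \<theta>s (\<theta> n \<omega>)) \<partial>M)
        \<le> (\<integral>\<^sup>+\<omega>\<in>B. ennreal ((1 + ?K * (\<gamma> (Suc n))\<^sup>2) * (norm (\<theta> n \<omega> - \<theta>s))\<^sup>2
        + ?K * (\<gamma> (Suc n))\<^sup>2) \<partial>M)" .
  qed (use sub mono \<theta>_meas assms(19,21,24) growth_const_nonneg continuous_drift in auto)
  moreover have "\<theta>s \<in> Argmin (importance_variance M X p F)"
    using min by (simp add: Argmin_def is_arg_min_def importance_variance_eq ennreal_less_iff V_nonneg not_less)
  ultimately show ?thesis by (intro exI[of _ "\<lambda>_. \<theta>s"]) simp
qed

end
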